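(* Let $\mathbb{K}$ be the projective Fraïssé limit of $\mathcal{K}$, let $q:\mathbb{K}\to K=\mathbb{K}/R^{\mathbb{K}}$ be the quotient map onto the universal Knaster continuum $K$, and let $\Phi:\mathrm{Aut}(\mathbb{K})\to\mathrm{Homeo}(K)$ be given by $\Phi(h)(q(x))=q(h(x))$ for $x\in\mathbb{K}$. Let $f,g:K\to L$ be continuous open surjections onto a Knaster continuum $L$ and let $\epsilon>0$. Then there exists $h\in\mathrm{Aut}(\mathbb{K})$ such that $$d_{\sup}(f\circ\Phi(h),g)<\epsilon .$$
   Context: For an integer $n\ge 2$, $\langle n\rangle$ denotes the pointed finite linear graph with vertex set $\{0,\dots,n-1\}$, edge relation $(i,j)\in R \iff |i-j|\le 1$, and zero-vertex $0$; every pointed finite linear graph (finite path with loops at all vertices and a designated end vertex, the zero-vertex) is isomorphic to some $\langle n\rangle$. An epimorphism takes edges to edges, is surjective on vertices and edges, and preserves the zero-vertex. $\mathcal{K}$ is the category of pointed finite linear graphs whose morphisms are all epimorphisms $f:\langle n\rangle\to\langle m\rangle$ for which there exist $0=i_0<\cdots<i_k=n-1$ such that $f$ restricted to each $[i_j,i_{j+1}]$ is monotone (non-increasing or non-decreasing), $f(i_j)=m-1$ for $j$ odd and $f(i_j)=0$ for $j$ even. $\mathcal{K}^\omega$ is the category of topological pointed graphs $\mathbb{L}=\varprojlim(L_n,g_n^{n+1})$ with $L_n\in\mathcal{K}$ and $g_n^{n+1}:L_{n+1}\to L_n$ in $\mathcal{K}$, with the product topology (each $L_n$ discrete), relation $(x,y)\in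 R^{\mathbb{L}}\iff (x_n,y_n)\in R^{L_n}$ for all $n$, and designated point $c^{\mathbb{L}}=(c^{L_n})_n$, where $c^{L_n}$ is the zero-vertex of $L_n$. A map $\phi:\varprojlim(K_n,f_n^{n+1})\to\varprojlim(L_n,g_n^{n+1})$ is a morphism of $\mathcal{K}^\omega$ if there are $i_1<i_2<\cdots$ and $\phi_n:K_{i_n}\to L_n$ in $\mathcal{K}$ with $\pi_n\circ\phi=\phi_n\circ\pi_{i_n}$ for every $n$, where $\pi_m$ denotes projection onto the $m$th coordinate. Objects of $\mathcal{K}$ are viewed in $\mathcal{K}^\omega$ as constant sequences with identity bonding maps. The projective Fraïssé limit $\mathbb{K}$ is the object of $\mathcal{K}^\omega$, unique up to isomorphism, such that (1) for each $A\in\mathcal{K}$ there is a morphism $\mathbb{K}\to A$; (2) for $A,B\in\mathcal{K}$ and morphisms $f:\mathbb{K}\to A$, $g:B\to A$ there is a morphism $h:\mathbb{K}\to B$ with $g\circ h=f$. $\mathrm{Aut}(\mathbb{K})$ is the group of automorphisms of $\mathbb{K}$ in $\mathcal{K}^\omega$. The relation $R^{\mathbb{K}}$ is an equivalence relation and $K:=\mathbb{K}/R^{\mathbb{K}}$ is the universal Knaster continuum; $\mathrm{Homeo}(K)$ is its group of homeomorphisms. Let $I=[0,1]$. A Knaster continuum is a continuum of the form $L=\varprojlim(I,T_n^{n+1})$ with each $T_n^{n+1}:I\to I$ a continuous open surjection mapping $0$ to $0$; its metric is $d_L(x,y)=\sum_{n\ge0}|x(n)-y(n)|/2^{n+1}$.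 The universal Knaster continuum is a Knaster continuum admitting continuous open surjections onto all other Knaster continua. For maps $u,v:K\to L$, $d_{\sup}(u,v)=\sup_{x\in K}d_L(u(x),v(x))$.
   Formalization: Added hypothesis: d_L(f(q(c)),g(q(c)))<ε, with c the designated point of 𝕂. Every Φ(h) fixes q(c), so this is necessary; without it the claim fails, e.g. for L an arc, g equal to f followed by the flip of the arc, and ε≤1. *)

theory Defs
  imports "HOL-Analysis.Analysis"
begin

section \<open>The category of pointed finite linear graphs\<close>

text \<open>The graph \<open>\<langle>n\<rangle>\<close> has vertex set \<open>{..<n}\<close> and zero-vertex \<open>0\<close>; only \<open>n \<ge> 2\<close> is used.
  Maps between such graphs are functions on \<open>nat\<close> whose values outside \<open>{..<n}\<close> are irrelevant.\<close>

definition lin_edges :: "nat \<Rightarrow> (nat \<times> nat) set" where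
  "lin_edges n = {(i, j). i < n \<and> j < n \<and> \<bar>int i - int j\<bar> \<le> 1}"

definition lin_epi :: "nat \<Rightarrow> nat \<Rightarrow> (nat \<Rightarrow> nat) \<Rightarrow> bool" where
  "lin_epi n m f \<longleftrightarrow> f ` {..<n} = {..<m} \<and> map_prod f f ` lin_edges n = lin_edges m \<and> f 0 = 0"

definition lin_mor :: "nat \<Rightarrow> nat \<Rightarrow> (nat \<Rightarrow> nat) \<Rightarrow> bool" where
  "lin_mor n m f \<longleftrightarrow> 2 \<le> n \<and> 2 \<le> m \<and> lin_epi n m f \<and>
     (\<exists>k i. i 0 = 0 \<and> i k = n - 1 \<and> (\<forall>j<k. i j < i (Suc j)) \<and>
        (\<forall>j<k. mono_on {i j..i (Suc j)} f \<or> antimono_on {i j..i (Suc j)} f) \<and>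
        (\<forall>j\<le>k. f (i j) = (if odd j then m - 1 else 0)))"

section \<open>Inverse limits\<close>

definition invlim :: "(nat \<Rightarrow> 'a topology) \<Rightarrow> (nat \<Rightarrow> 'a \<Rightarrow> 'a) \<Rightarrow> (nat \<Rightarrow> 'a) topology" where
  "invlim X b = subtopology (product_topology X UNIV) {x. \<forall>n. b n (x (Suc n)) = x n}"

lemma topspace_invlim:
  "topspace (invlim X b) = {x. (\<forall>n. x n \<in> topspace (X n)) \<and> (\<forall>n. b n (x (Suc n)) = x n)}"
  unfolding invlim_def by (auto simp: PiE_UNIV_domain)

section \<open>Limits of pointed finite linear graphs\<close>

text \<open>An inverse sequence is a pair of the sequence of sizes and the sequence of bonding maps;
  \<open>snd L n\<close> maps the \<open>(n+1)\<close>-st graph to the \<open>n\<close>-th one.\<close>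

type_synonym lin_seq = "(nat \<Rightarrow> nat) \<times> (nat \<Rightarrow> nat \<Rightarrow> nat)"

definition is_lin_seq :: "lin_seq \<Rightarrow> bool" where
  "is_lin_seq L \<longleftrightarrow> (\<forall>n. lin_mor (fst L (Suc n)) (fst L n) (snd L n))"

definition lim_top :: "lin_seq \<Rightarrow> (nat \<Rightarrow> nat) topology" where
  "lim_top L = invlim (\<lambda>n. discrete_topology {..<fst L n}) (snd L)"

abbreviation lim_pts :: "lin_seq \<Rightarrow> (nat \<Rightarrow> nat) set" where
  "lim_pts L \<equiv> topspace (lim_top L)"

definition lim_rel :: "lin_seq \<Rightarrow> ((nat \<Rightarrow> nat) \<times> (nat \<Rightarrow> nat)) set" where
  "lim_rel L = {(x, y). x \<in> lim_pts L \<and> y \<in> lim_pts L \<and> (\<forall>n. (x n, y n) \<in> lin_edges (fst L n))}"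

definition lim_zero :: "nat \<Rightarrow> nat" where
  "lim_zero = (\<lambda>n. 0)"

definition lim_mor :: "lin_seq \<Rightarrow> lin_seq \<Rightarrow> ((nat \<Rightarrow> nat) \<Rightarrow> (nat \<Rightarrow> nat)) \<Rightarrow> bool" where
  "lim_mor K L \<phi> \<longleftrightarrow> \<phi> ` lim_pts K \<subseteq> lim_pts L \<and>
     (\<exists>i \<phi>'. strict_mono (i :: nat \<Rightarrow> nat) \<and>
        (\<forall>n. lin_mor (fst K (i n)) (fst L n) (\<phi>' n) \<and>
             (\<forall>x\<in>lim_pts K. \<phi> x n = \<phi>' n (x (i n)))))"

definition const_seq :: "nat \<Rightarrow> lin_seq" where
  "const_seq m = (\<lambda>_. m, \<lambda>_. id)"

definition fraisse_limit :: "lin_seq \<Rightarrow> bool" where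
  "fraisse_limit K \<longleftrightarrow> is_lin_seq K \<and>
     (\<forall>a\<ge>2. \<exists>\<phi>. lim_mor K (const_seq a) \<phi>) \<and>
     (\<forall>a\<ge>2. \<forall>b\<ge>2. \<forall>f g. lim_mor K (const_seq a) f \<longrightarrow> lim_mor (const_seq b) (const_seq a) g \<longrightarrow>
        (\<exists>h. lim_mor K (const_seq b) h \<and> (\<forall>x\<in>lim_pts K. g (h x) = f x)))"

definition lim_Aut :: "lin_seq \<Rightarrow> ((nat \<Rightarrow> nat) \<Rightarrow> (nat \<Rightarrow> nat)) set" where
  "lim_Aut K = {h. lim_mor K K h \<and>
     (\<exists>h'. lim_mor K K h' \<and> (\<forall>x\<in>lim_pts K. h' (h x) = x \<and> h (h' x) = x))}"

section \<open>The quotient by the edge relation\<close>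

definition quot_map :: "lin_seq \<Rightarrow> (nat \<Rightarrow> nat) \<Rightarrow> (nat \<Rightarrow> nat) set" where
  "quot_map K x = lim_rel K `` {x}"

definition final_topology :: "'a topology \<Rightarrow> ('a \<Rightarrow> 'b) \<Rightarrow> 'b topology" where
  "final_topology X q = topology (\<lambda>U. U \<subseteq> q ` topspace X \<and> openin X {x \<in> topspace X. q x \<in> U})"

lemma openin_final_topology:
  "openin (final_topology X q) U \<longleftrightarrow> U \<subseteq> q ` topspace X \<and> openin X {x \<in> topspace X. q x \<in> U}"
proof -
  have "istopology (\<lambda>U. U \<subseteq> q ` topspace X \<and> openin X {x \<in> topspace X. q x \<in> U})"
    unfolding istopology_def
  proof (intro conjI allI impI)
    fix S T
    assume "S \<subseteq> q ` topspace X \<and> openin X {x \<in> topspace X. q x \<in> S}"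
      and "T \<subseteq> q ` topspace X \<and> openin X {x \<in> topspace X. q x \<in> T}"
    moreover have "{x \<in> topspace X. q x \<in> S \<inter> T} = {x \<in> topspace X. q x \<in> S} \<inter> {x \<in> topspace X. q x \<in> T}"
      by auto
    ultimately show "S \<inter> T \<subseteq> q ` topspace X" "openin X {x \<in> topspace X. q x \<in> S \<inter> T}"
      by auto
  next
    fix \<K>
    assume *: "\<forall>U\<in>\<K>. U \<subseteq> q ` topspace X \<and> openin X {x \<in> topspace X. q x \<in> U}"
    have "{x \<in> topspace X. q x \<in> \<Union>\<K>} = (\<Union>U\<in>\<K>. {x \<in> topspace X. q x \<in> U})"
      by auto
    then show "\<Union>\<K> \<subseteq> q ` topspace X" "openin X {x \<in> topspace X. q x \<in> \<Union>\<K>}"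
      using * by auto
  qed
  then show ?thesis
    by (simp add: final_topology_def topology_inverse')
qed

lemma topspace_final_topology: "topspace (final_topology X q) = q ` topspace X"
proof
  show "topspace (final_topology X q) \<subseteq> q ` topspace X"
    using openin_final_topology[of X q "topspace (final_topology X q)"] by simp
  have "{x \<in> topspace X. q x \<in> q ` topspace X} = topspace X"
    by auto
  then have "openin (final_topology X q) (q ` topspace X)"
    by (simp add: openin_final_topology)
  then show "q ` topspace X \<subseteq> topspace (final_topology X q)"
    by (rule openin_subset)
qed

lemma quotient_map_final_topology: "quotient_map X (final_topology X q) q"
  by (auto simp: quotient_map_def topspace_final_topology openin_final_topology)

definition quot_top :: "lin_seq \<Rightarrow> (nat \<Rightarrow> nat) set topology" where
  "quot_top K = final_topology (lim_top K) (quot_map K)"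

definition Phi :: "lin_seq \<Rightarrow> ((nat \<Rightarrow> nat) \<Rightarrow> (nat \<Rightarrow> nat)) \<Rightarrow> (nat \<Rightarrow> nat) set \<Rightarrow> (nat \<Rightarrow> nat) set" where
  "Phi K h C = (THE D. \<exists>x\<in>lim_pts K. quot_map K x = C \<and> D = quot_map K (h x))"

section \<open>Knaster continua\<close>

abbreviation unit_top :: "real topology" where
  "unit_top \<equiv> top_of_set {0..1}"

definition cont_open_surj :: "'a topology \<Rightarrow> 'b topology \<Rightarrow> ('a \<Rightarrow> 'b) \<Rightarrow> bool" where
  "cont_open_surj X Y f \<longleftrightarrow> continuous_map X Y f \<and> open_map X Y f \<and> f ` topspace X = topspace Y"

definition is_knaster_seq :: "(nat \<Rightarrow> real \<Rightarrow> real) \<Rightarrow> bool" where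
  "is_knaster_seq T \<longleftrightarrow> (\<forall>n. cont_open_surj unit_top unit_top (T n) \<and> T n 0 = 0)"

definition knaster_top :: "(nat \<Rightarrow> real \<Rightarrow> real) \<Rightarrow> (nat \<Rightarrow> real) topology" where
  "knaster_top T = invlim (\<lambda>n. unit_top) T"

definition knaster_dist :: "(nat \<Rightarrow> real) \<Rightarrow> (nat \<Rightarrow> real) \<Rightarrow> real" where
  "knaster_dist x y = (\<Sum>n. \<bar>x n - y n\<bar> / 2 ^ (n + 1))"

definition sup_dist :: "'a set \<Rightarrow> ('a \<Rightarrow> nat \<Rightarrow> real) \<Rightarrow> ('a \<Rightarrow> nat \<Rightarrow> real) \<Rightarrow> real" where
  "sup_dist X u v = (SUP x\<in>X. knaster_dist (u x) (v x))"

section \<open>Sanity checks\<close>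

lemma lim_zero_in:
  assumes "is_lin_seq K" shows "lim_zero \<in> lim_pts K"
  using assms
  by (auto simp: lim_top_def topspace_invlim lim_zero_def is_lin_seq_def lin_mor_def lin_epi_def
      intro: less_le_trans[of 0 2])

lemma lim_mor_zero: "lim_mor K L \<phi> \<Longrightarrow> lim_zero \<in> lim_pts K \<Longrightarrow> \<phi> lim_zero = lim_zero"
  by (force simp: lim_mor_def lim_zero_def lin_mor_def lin_epi_def)

lemma lim_mor_rel:
  assumes "lim_mor K L \<phi>" "(x, y) \<in> lim_rel K" shows "(\<phi> x, \<phi> y) \<in> lim_rel L"
proof -
  obtain i \<phi>' where *: "\<And>n. lin_mor (fst K (i n)) (fst L n) (\<phi>' n)"
      "\<And>n x. x \<in> lim_pts K \<Longrightarrow> \<phi> x n = \<phi>' n (x (i n))" "\<phi> ` lim_pts K \<subseteq> lim_pts L"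
    using assms(1) unfolding lim_mor_def by metis
  have xy: "x \<in> lim_pts K" "y \<in> lim_pts K" "\<And>n. (x n, y n) \<in> lin_edges (fst K n)"
    using assms(2) by (auto simp: lim_rel_def)
  have "(\<phi> x n, \<phi> y n) \<in> lin_edges (fst L n)" for n
  proof -
    have "map_prod (\<phi>' n) (\<phi>' n) ` lin_edges (fst K (i n)) = lin_edges (fst L n)"
      using *(1)[of n] by (simp add: lin_mor_def lin_epi_def)
    then have "map_prod (\<phi>' n) (\<phi>' n) (x (i n), y (i n)) \<in> lin_edges (fst L n)"
      using xy(3)[of "i n"] by blast
    then show ?thesis
      using xy * by simp
  qed
  then show ?thesis
    using xy * by (auto simp: lim_rel_def)
qed

text \<open>\<open>Phi K h\<close> is well defined for automorphisms \<open>h\<close>.\<close>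

lemma Phi_quot_map:
  assumes h: "h \<in> lim_Aut K" and x: "x \<in> lim_pts K"
  shows "Phi K h (quot_map K x) = quot_map K (h x)"
proof -
  obtain h' where h': "lim_mor K K h'" "\<And>x. x \<in> lim_pts K \<Longrightarrow> h' (h x) = x"
      "\<And>x. x \<in> lim_pts K \<Longrightarrow> h (h' x) = x" and hm: "lim_mor K K h"
    using h unfolding lim_Aut_def by blast
  have img: "quot_map K (h y) = h ` quot_map K y" if y: "y \<in> lim_pts K" for y
  proof (intro equalityI subsetI)
    fix z assume "z \<in> quot_map K (h y)"
    then have z: "(h y, z) \<in> lim_rel K" by (simp add: quot_map_def)
    then have "(y, h' z) \<in> lim_rel K" using lim_mor_rel[OF h'(1) z] h'(2) y by simp
    moreover have "h (h' z) = z" using z h'(3) by (simp add: lim_rel_def)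
    ultimately show "z \<in> h ` quot_map K y" by (force simp: quot_map_def)
  next
    fix z assume "z \<in> h ` quot_map K y"
    then show "z \<in> quot_map K (h y)"
      using lim_mor_rel[OF hm] by (auto simp: quot_map_def)
  qed
  show ?thesis
    unfolding Phi_def
  proof (rule the_equality)
    show "\<exists>y\<in>lim_pts K. quot_map K y = quot_map K x \<and> quot_map K (h x) = quot_map K (h y)"
      using x by blast
  next
    fix D assume "\<exists>y\<in>lim_pts K. quot_map K y = quot_map K x \<and> D = quot_map K (h y)"
    then show "D = quot_map K (h x)" using img x by auto
  qed
qed

text \<open>\<open>Phi K h\<close> is a homeomorphism.\<close>

lemma continuous_map_lim_mor:
  assumes "lim_mor K L \<phi>" shows "continuous_map (lim_top K) (lim_top L) \<phi>"
proof -
  obtain i \<phi>' where *: "\<And>n. lin_mor (fst K (i n)) (fst L n) (\<phi>' n)"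
      "\<And>n x. x \<in> lim_pts K \<Longrightarrow> \<phi> x n = \<phi>' n (x (i n))" "\<phi> ` lim_pts K \<subseteq> lim_pts L"
    using assms unfolding lim_mor_def by metis
  have "continuous_map (lim_top K) (discrete_topology {..<fst L n}) (\<lambda>x. \<phi> x n)" for n
  proof -
    have "continuous_map (lim_top K) (discrete_topology {..<fst K (i n)}) (\<lambda>x. x (i n))"
      unfolding lim_top_def invlim_def
      by (intro continuous_map_from_subtopology continuous_map_product_projection) simp
    moreover have "continuous_map (discrete_topology {..<fst K (i n)})
        (discrete_topology {..<fst L n}) (\<phi>' n)"
      using *(1)[of n] by (auto simp: lin_mor_def lin_epi_def)
    ultimately have "continuous_map (lim_top K) (discrete_topology {..<fst L n}) (\<phi>' n \<circ> (\<lambda>x. x (i n)))"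
      by (rule continuous_map_compose)
    then show ?thesis
      by (rule continuous_map_eq) (simp add: *)
  qed
  then have "continuous_map (lim_top K) (product_topology (\<lambda>n. discrete_topology {..<fst L n}) UNIV) \<phi>"
    by (simp add: continuous_map_componentwise_UNIV)
  moreover have "\<phi> \<in> lim_pts K \<rightarrow> {x. \<forall>n. snd L n (x (Suc n)) = x n}"
    using *(3) by (auto simp: lim_top_def topspace_invlim)
  ultimately show ?thesis
    by (subst (2) lim_top_def) (simp add: invlim_def continuous_map_in_subtopology image_subset_iff_funcset)
qed

lemma homeomorphic_map_Phi:
  assumes h: "h \<in> lim_Aut K" shows "homeomorphic_map (quot_top K) (quot_top K) (Phi K h)"
proof -
  obtain h' where h': "lim_mor K K h'" "\<And>x. x \<in> lim_pts K \<Longrightarrow> h' (h x) = x"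
      "\<And>x. x \<in> lim_pts K \<Longrightarrow> h (h' x) = x" and hm: "lim_mor K K h"
    using h unfolding lim_Aut_def by blast
  then have h'A: "h' \<in> lim_Aut K"
    unfolding lim_Aut_def by blast
  have ts: "topspace (quot_top K) = quot_map K ` lim_pts K"
    by (simp add: quot_top_def topspace_final_topology)
  have qm: "quotient_map (lim_top K) (quot_top K) (quot_map K)"
    by (simp add: quot_top_def quotient_map_final_topology)
  have cont: "continuous_map (quot_top K) (quot_top K) (Phi K u)" if u: "u \<in> lim_Aut K" for u
  proof -
    have um: "lim_mor K K u" using u by (simp add: lim_Aut_def)
    have "continuous_map (lim_top K) (quot_top K) (quot_map K \<circ> u)"
      using continuous_map_compose[OF continuous_map_lim_mor[OF um] quotient_imp_continuous_map[OF qm]] .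
    then have "continuous_map (lim_top K) (quot_top K) (Phi K u \<circ> quot_map K)"
      by (rule continuous_map_eq) (simp add: Phi_quot_map[OF u])
    then show ?thesis
      by (rule continuous_compose_quotient_map[OF qm])
  qed
  have in1: "h x \<in> lim_pts K" "h' x \<in> lim_pts K" if "x \<in> lim_pts K" for x
    using that hm h'(1) by (auto simp: lim_mor_def)
  have "homeomorphic_maps (quot_top K) (quot_top K) (Phi K h) (Phi K h')"
    unfolding homeomorphic_maps_def
    using cont[OF h] cont[OF h'A] in1 h' by (auto simp: ts Phi_quot_map[OF h] Phi_quot_map[OF h'A])
  then show ?thesis
    by (rule homeomorphic_maps_map[THEN iffD1, THEN conjunct1])
qed

text \<open>Every \<open>Phi K h\<close> fixes the designated point of the quotient. Hence two surjections can be
  brought to distance less than \<open>\<epsilon>\<close> by some \<open>Phi K h\<close> only if their values at that point already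
  are. This can fail if the Knaster continuum has two endpoints (for
  example, if \<open>T n 1 = 1\<close> for all \<open>n\<close>).\<close>

lemma sup_dist_necessary:
  assumes K: "fraisse_limit K" and h: "h \<in> lim_Aut K"
    and f: "cont_open_surj (quot_top K) (knaster_top T) f"
    and g: "cont_open_surj (quot_top K) (knaster_top T) g"
    and *: "sup_dist (topspace (quot_top K)) (f \<circ> Phi K h) g < \<epsilon>"
  shows "knaster_dist (f (quot_map K lim_zero)) (g (quot_map K lim_zero)) < \<epsilon>"
proof -
  have z: "lim_zero \<in> lim_pts K"
    using K by (simp add: fraisse_limit_def lim_zero_in)
  have ts: "topspace (quot_top K) = quot_map K ` lim_pts K"
    by (simp add: quot_top_def topspace_final_topology)
  have hz: "Phi K h (quot_map K lim_zero) = quot_map K lim_zero"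
    using Phi_quot_map[OF h z] h z lim_mor_zero[of K K h] by (simp add: lim_Aut_def)
  have bd: "knaster_dist x y \<le> 1"
    if "x \<in> topspace (knaster_top T)" "y \<in> topspace (knaster_top T)" for x y
  proof -
    have xy: "\<bar>x n - y n\<bar> \<le> 1" for n
    proof -
      have "x n \<in> {0..1}" "y n \<in> {0..1}"
        using that by (auto simp: knaster_top_def topspace_invlim)
      then show ?thesis by auto
    qed
    have s: "(\<lambda>n. 1 / 2 ^ (n + 1) :: real) sums 1"
      using power_half_series by (simp add: power_one_over)
    have le: "\<bar>x n - y n\<bar> / 2 ^ (n + 1) \<le> 1 / 2 ^ (n + 1)" for n
      using xy[of n] by (simp add: divide_right_mono)
    have sm: "summable (\<lambda>n. \<bar>x n - y n\<bar> / 2 ^ (n + 1))"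
      by (rule summable_comparison_test'[OF sums_summable[OF s]]) (use le in auto)
    have "knaster_dist x y \<le> (\<Sum>n. 1 / 2 ^ (n + 1))"
      unfolding knaster_dist_def by (rule suminf_le[OF le sm sums_summable[OF s]])
    then show ?thesis
      using sums_unique[OF s] by simp
  qed
  have "Phi K h ` topspace (quot_top K) \<subseteq> topspace (quot_top K)"
    using homeomorphic_imp_surjective_map[OF homeomorphic_map_Phi[OF h]] by simp
  then have "bdd_above ((\<lambda>x. knaster_dist ((f \<circ> Phi K h) x) (g x)) ` topspace (quot_top K))"
    using f g by (intro bdd_aboveI2[where M = 1] bd) (auto simp: cont_open_surj_def)
  then have "knaster_dist ((f \<circ> Phi K h) (quot_map K lim_zero)) (g (quot_map K lim_zero))
      \<le> sup_dist (topspace (quot_top K)) (f \<circ> Phi K h) g"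
    unfolding sup_dist_def using z ts by (intro cSUP_upper) auto
  then show ?thesis
    using * hz by simp
qed

end

theory Submission
  imports Defs
begin

text \<open>
  An automorphism of the limit can be prescribed on a finite level: any two morphisms \<open>u\<close>, \<open>v\<close> from
  the limit to the same graph \<open>\<langle>k\<rangle>\<close> satisfy \<open>u \<circ> h = v\<close> for some automorphism \<open>h\<close>
  (\<open>fraisse_limit_homogeneous\<close>). To bring \<open>f\<close> near \<open>g\<close> it is therefore enough to show that both are,
  up to a small error and in the relevant coordinate, morphisms to the same \<open>\<langle>k\<rangle>\<close>.

  Let \<open>F\<close> be one coordinate of \<open>f\<close>. It is an open map from the quotient onto \<open>[0,1]\<close>, since projections of
  inverse limits with open bonding maps are open. By compactness \<open>F\<close> is nearly a function \<open>G\<close> on the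
  vertices of a single level. Openness restricts how \<open>G\<close> can turn. Over an interval of vertices at whose
  ends \<open>G\<close> is large, the minimum of \<open>F\<close> is the least element of an open subset of \<open>[0,1]\<close>, so it is \<open>0\<close>.
  Hence every noticeable valley of \<open>G\<close> comes near \<open>0\<close>, and symmetrically every peak comes near \<open>1\<close>
  (\<open>sampled_valleys_sink\<close>). Morphisms of finite graphs are, apart from conditions at the
  end vertices, the surjections with steps of size at most one all of whose valleys and peaks reach the
  ends of the range (\<open>lin_mor_iff_fold_map\<close>). Rounding a multiple of \<open>G\<close>
  to integers with hysteresis, which suppresses the small oscillations, thus produces a
  morphism close to \<open>F\<close> (\<open>level_mor_approximation\<close>).

  Morphisms send the designated point \<open>c\<close> to \<open>0\<close>. The same analysis at the end of the level shows that \<open>F\<close>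
  takes \<open>c\<close> to \<open>0\<close> or \<open>1\<close> (\<open>endpoint_to_endpoint\<close>), and up to the reflection of \<open>[0,1]\<close> the argument applies to
  every coordinate in which \<open>f c\<close> and \<open>g c\<close> agree. If \<open>N\<close> is the first coordinate in which they differ,
  they differ by \<open>1\<close> from there on, and so their distance is \<open>1 / 2 ^ N\<close>, which is less than \<open>\<epsilon>\<close> by assumption.
  Controlling the coordinate \<open>N - 1\<close> controls all earlier ones by uniform continuity, and the later ones
  contribute at most \<open>1 / 2 ^ N\<close> to any distance.
\<close>

section \<open>Folding maps between finite linear graphs\<close>

text \<open>A piecewise linear map of an interval without constant pieces that sends its left end to \<open>0\<close> is open
  iff it turns back only at the two ends of its range and takes the right end of its domain to one of them. This is the discrete
  form of that condition: \<open>f b\<close> lies in a valley if \<open>f\<close> is larger somewhere on both sides of \<open>b\<close>, and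
  every valley must touch the bottom, every peak the top. Stated without a subdivision of the domain,
  the condition is easy to check for composites and for maps that are built by recursion.\<close>

definition fold_map :: "nat \<Rightarrow> nat \<Rightarrow> (nat \<Rightarrow> nat) \<Rightarrow> bool" where
  "fold_map n m f \<longleftrightarrow> 2 \<le> n \<and> 2 \<le> m \<and> f 0 = 0 \<and> f (n - 1) \<in> {0, m - 1} \<and>
     (\<forall>v<n. f v < m) \<and> (\<exists>v<n. f v = m - 1) \<and>
     (\<forall>v. Suc v < n \<longrightarrow> f (Suc v) \<le> Suc (f v) \<and> f v \<le> Suc (f (Suc v))) \<and>
     (\<forall>a b c. a \<le> b \<and> b \<le> c \<and> c < n \<and> f b < f a \<and> f b < f c \<longrightarrow> (\<exists>d\<in>{a..c}. f d = 0)) \<and>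
     (\<forall>a b c. a \<le> b \<and> b \<le> c \<and> c < n \<and> f a < f b \<and> f c < f b \<longrightarrow> (\<exists>d\<in>{a..c}. f d = m - 1))"

lemma fold_mapD:
  assumes "fold_map n m f"
  shows "2 \<le> n" "2 \<le> m" "f 0 = 0" "f (n - 1) = 0 \<or> f (n - 1) = m - 1"
    "v < n \<Longrightarrow> f v < m" "\<exists>v<n. f v = m - 1"
    "Suc v < n \<Longrightarrow> f (Suc v) \<le> Suc (f v)" "Suc v < n \<Longrightarrow> f v \<le> Suc (f (Suc v))"
    "a \<le> b \<Longrightarrow> b \<le> c \<Longrightarrow> c < n \<Longrightarrow> f b < f a \<Longrightarrow> f b < f c \<Longrightarrow> \<exists>d\<in>{a..c}. f d = 0"
    "a \<le> b \<Longrightarrow> b \<le> c \<Longrightarrow> c < n \<Longrightarrow> f a < f b \<Longrightarrow> f c < f b \<Longrightarrow> \<exists>d\<in>{a..c}. f d = m - 1"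
  using assms unfolding fold_map_def by auto

lemma fold_map_intermediate_value:
  assumes f: "fold_map n m f" and xy: "x < n" "y < n" and k: "f x \<le> k" "k \<le> f y"
  shows "\<exists>d\<in>{min x y..max x y}. f d = k"
proof (cases "x \<le> y")
  case True
  have "\<exists>i. x \<le> i \<and> i \<le> y \<and> int (f i) = int k"
  proof (rule nat_intermed_int_val)
    show "\<forall>i. x \<le> i \<and> i < y \<longrightarrow> \<bar>int (f (Suc i)) - int (f i)\<bar> \<le> 1"
    proof (intro allI impI)
      fix i assume "x \<le> i \<and> i < y"
      then have "Suc i < n" using xy by simp
      from fold_mapD(7,8)[OF f this] show "\<bar>int (f (Suc i)) - int (f i)\<bar> \<le> 1" by simp
    qed
  qed (use True k in auto)
  then show ?thesis using True by auto
next
  case False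
  have "\<exists>i. y \<le> i \<and> i \<le> x \<and> - int (f i) = - int k"
  proof (rule nat_intermed_int_val)
    show "\<forall>i. y \<le> i \<and> i < x \<longrightarrow> \<bar>- int (f (Suc i)) - - int (f i)\<bar> \<le> 1"
    proof (intro allI impI)
      fix i assume "y \<le> i \<and> i < x"
      then have "Suc i < n" using xy by simp
      from fold_mapD(7,8)[OF f this] show "\<bar>- int (f (Suc i)) - - int (f i)\<bar> \<le> 1" by simp
    qed
  qed (use False k in auto)
  then show ?thesis using False by auto
qed

lemma lin_mor_imp_fold_map:
  assumes "lin_mor n m f"
  shows "fold_map n m f"
proof -
  from assms obtain k i where nm: "2 \<le> n" "2 \<le> m" and epi: "lin_epi n m f"
    and i0: "i 0 = 0" and ik: "i k = n - 1" and inc: "\<And>j. j < k \<Longrightarrow> i j < i (Suc j)"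
    and mon: "\<And>j. j < k \<Longrightarrow> mono_on {i j..i (Suc j)} f \<or> antimono_on {i j..i (Suc j)} f"
    and val: "\<And>j. j \<le> k \<Longrightarrow> f (i j) = (if odd j then m - 1 else 0)"
    unfolding lin_mor_def by blast
  have img: "f ` {..<n} = {..<m}" and edg: "map_prod f f ` lin_edges n = lin_edges m" and f0: "f 0 = 0"
    using epi by (auto simp: lin_epi_def)
  have rng: "f v < m" if "v < n" for v
    using img that by blast
  have lip: "f (Suc v) \<le> Suc (f v) \<and> f v \<le> Suc (f (Suc v))" if "Suc v < n" for v
  proof -
    have "(v, Suc v) \<in> lin_edges n" using that by (auto simp: lin_edges_def)
    then have "(f v, f (Suc v)) \<in> lin_edges m" using edg by (metis map_prod_imageI)
    then show ?thesis by (auto simp: lin_edges_def)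
  qed
  have mono: "mono_on {i j..i (Suc j)} f" if "j < k" "even j" for j
  proof (rule ccontr)
    assume "\<not> mono_on {i j..i (Suc j)} f"
    then have "f (i (Suc j)) \<le> f (i j)"
      using mon[OF that(1)] inc[OF that(1)] by (auto simp: monotone_on_def)
    then show False using val[of j] val[of "Suc j"] that nm by auto
  qed
  have anti: "antimono_on {i j..i (Suc j)} f" if "j < k" "odd j" for j
  proof (rule ccontr)
    assume "\<not> antimono_on {i j..i (Suc j)} f"
    then have "f (i j) \<le> f (i (Suc j))"
      using mon[OF that(1)] inc[OF that(1)] by (auto simp: monotone_on_def)
    then show False using val[of j] val[of "Suc j"] that nm by auto
  qed
  have seg: "\<exists>j<k. i j \<le> b \<and> b \<le> i (Suc j)" if "b < n" for b
  proof -
    have "\<exists>j<k'. i j \<le> b \<and> b \<le> i (Suc j)" if "0 < k'" "k' \<le> k" "b \<le> i k'" for k'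
      using that
    proof (induction k')
      case (Suc k')
      show ?case
      proof (cases "b \<le> i k' \<and> 0 < k'")
        case True
        then show ?thesis using Suc by (meson Suc_leD less_Suc_eq)
      next
        case False
        then have "i k' \<le> b" using i0 by (metis bot_nat_0.not_eq_extremum le_zero_eq linear)
        then show ?thesis using Suc by blast
      qed
    qed simp
    moreover have "0 < k" using ik i0 nm by (cases k) auto
    ultimately show ?thesis using ik that by auto
  qed
  have valley: "\<exists>d\<in>{a..c}. f d = 0"
    if abc: "a \<le> b" "b \<le> c" "c < n" "f b < f a" "f b < f c" for a b c
  proof -
    obtain j where j: "j < k" "i j \<le> b" "b \<le> i (Suc j)" using seg[of b] abc by auto
    show ?thesis
    proof (cases "even j")
      case True
      have "a < i j"
      proof (rule ccontr)
        assume "\<not> a < i j"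
        then show False using monotone_onD[OF mono[OF j(1) True], of a b] j abc by auto
      qed
      then show ?thesis using val[of j] True j abc by (intro bexI[of _ "i j"]) auto
    next
      case False
      have "i (Suc j) < c"
      proof (rule ccontr)
        assume "\<not> i (Suc j) < c"
        then show False using monotone_onD[OF anti[OF j(1) False], of b c] j abc by auto
      qed
      then show ?thesis using val[of "Suc j"] False j abc by (intro bexI[of _ "i (Suc j)"]) auto
    qed
  qed
  have peak: "\<exists>d\<in>{a..c}. f d = m - 1"
    if abc: "a \<le> b" "b \<le> c" "c < n" "f a < f b" "f c < f b" for a b c
  proof -
    obtain j where j: "j < k" "i j \<le> b" "b \<le> i (Suc j)" using seg[of b] abc by auto
    show ?thesis
    proof (cases "even j")
      case True
      have "i (Suc j) < c"
      proof (rule ccontr)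
        assume "\<not> i (Suc j) < c"
        then show False using monotone_onD[OF mono[OF j(1) True], of b c] j abc by auto
      qed
      then show ?thesis using val[of "Suc j"] True j abc by (intro bexI[of _ "i (Suc j)"]) auto
    next
      case False
      have "a < i j"
      proof (rule ccontr)
        assume "\<not> a < i j"
        then show False using monotone_onD[OF anti[OF j(1) False], of a b] j abc by auto
      qed
      then show ?thesis using val[of j] False j abc by (intro bexI[of _ "i j"]) auto
    qed
  qed
  have "\<exists>v<n. f v = m - 1"
  proof -
    have "m - 1 \<in> f ` {..<n}" using img nm by simp
    then show ?thesis by auto
  qed
  moreover have "f (n - 1) \<in> {0, m - 1}" using val[of k] ik by auto
  ultimately show ?thesis
    unfolding fold_map_def using nm f0 rng lip valley peak by blast
qed

text \<open>The condition that \<open>lin_mor\<close> asks of the subdivision \<open>i 0 < \<dots> < i k\<close>, imposed on the initial segment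
  \<open>{0..q}\<close>, together with what is known about the unfinished monotone piece \<open>{i k..q}\<close>. By the last
  clause \<open>f\<close> has left its value at \<open>i k\<close> by the time of \<open>q\<close>, so that \<open>n - 1\<close> can only be sent to the opposite
  extreme value when \<open>q\<close> arrives there.\<close>

definition turning_points :: "nat \<Rightarrow> (nat \<Rightarrow> nat) \<Rightarrow> nat \<Rightarrow> nat \<Rightarrow> (nat \<Rightarrow> nat) \<Rightarrow> bool" where
  "turning_points m f q k i \<longleftrightarrow> i 0 = 0 \<and> i k \<le> q \<and> (\<forall>j<k. i j < i (Suc j)) \<and>
     (\<forall>j<k. mono_on {i j..i (Suc j)} f \<or> antimono_on {i j..i (Suc j)} f) \<and>
     (\<forall>j\<le>k. f (i j) = (if odd j then m - 1 else 0)) \<and>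
     (odd k \<longrightarrow> antimono_on {i k..q} f) \<and> (even k \<longrightarrow> mono_on {i k..q} f) \<and>
     (k = 0 \<or> f q \<noteq> f (i k))"

lemma turning_pointsD:
  assumes "turning_points m f q k i"
  shows "i 0 = 0" "i k \<le> q" "j < k \<Longrightarrow> i j < i (Suc j)"
    "j < k \<Longrightarrow> mono_on {i j..i (Suc j)} f \<or> antimono_on {i j..i (Suc j)} f"
    "j \<le> k \<Longrightarrow> f (i j) = (if odd j then m - 1 else 0)"
    "odd k \<Longrightarrow> antimono_on {i k..q} f" "even k \<Longrightarrow> mono_on {i k..q} f"
    "k = 0 \<or> f q \<noteq> f (i k)"
  using assms unfolding turning_points_def by blast+

text \<open>Moving \<open>q\<close> one step to the right keeps the subdivision unless \<open>f\<close> reverses its direction at \<open>q\<close>. A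
  reversal is a valley or a peak between \<open>i k\<close> and \<open>Suc q\<close>, so \<open>f\<close> is extremal somewhere there; as \<open>f\<close>
  is monotone up to \<open>q\<close>, it is extremal at \<open>q\<close>, which is the next turning point.\<close>

lemma fold_map_turning_points:
  assumes f: "fold_map n m f" and "q < n"
  shows "\<exists>k i. turning_points m f q k i"
  using \<open>q < n\<close>
proof (induction q)
  case 0
  have "turning_points m f 0 0 (\<lambda>_. 0)"
    using fold_mapD(3)[OF f] by (simp add: turning_points_def monotone_on_def)
  then show ?case by blast
next
  case (Suc q)
  then obtain k i where tp: "turning_points m f q k i" by auto
  note i0 = turning_pointsD(1)[OF tp] and ik = turning_pointsD(2)[OF tp]
    and inc = turning_pointsD(3)[OF tp] and mon = turning_pointsD(4)[OF tp]
    and val = turning_pointsD(5)[OF tp] and dir = turning_pointsD(6,7)[OF tp]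
    and ne = turning_pointsD(8)[OF tp]
  have fq: "f q < m" "f (Suc q) < m" using fold_mapD(5)[OF f] Suc.prems by auto
  show ?case
  proof (cases "if odd k then f (Suc q) \<le> f q else f q \<le> f (Suc q)")
    case True
    have "(odd k \<longrightarrow> antimono_on {i k..Suc q} f) \<and> (even k \<longrightarrow> mono_on {i k..Suc q} f)"
    proof (cases "odd k")
      case odd: True
      have "f y \<le> f x" if "i k \<le> x" "x \<le> y" "y \<le> Suc q" for x y
      proof (cases "y = Suc q")
        case y: True
        have "f q \<le> f x" if "x \<le> q"
          using monotone_onD[of "{i k..q}" _ _ f x q] dir odd \<open>i k \<le> x\<close> that by auto
        then show ?thesis using True odd y \<open>x \<le> y\<close> by (cases "x = y") auto
      next
        case False
        then show ?thesis
          using monotone_onD[of "{i k..q}" _ _ f x y] dir odd that by auto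
      qed
      then show ?thesis using odd by (auto simp: monotone_on_def)
    next
      case even: False
      have "f x \<le> f y" if "i k \<le> x" "x \<le> y" "y \<le> Suc q" for x y
      proof (cases "y = Suc q")
        case y: True
        have "f x \<le> f q" if "x \<le> q"
          using monotone_onD[of "{i k..q}" _ _ f x q] dir even \<open>i k \<le> x\<close> that by auto
        then show ?thesis using True even y \<open>x \<le> y\<close> by (cases "x = y") auto
      next
        case False
        then show ?thesis
          using monotone_onD[of "{i k..q}" _ _ f x y] dir even that by auto
      qed
      then show ?thesis using even by (auto simp: monotone_on_def)
    qed
    moreover have "k = 0 \<or> f (Suc q) \<noteq> f (i k)"
    proof (cases "k = 0")
      case False
      then have "f q \<noteq> f (i k)" using ne by simp
      then show ?thesis using True val[of k] fq by (auto split: if_splits)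
    qed simp
    ultimately have "turning_points m f (Suc q) k i"
      unfolding turning_points_def using i0 ik inc mon val by simp
    then show ?thesis by blast
  next
    case False
    have ext: "f q = (if odd k then 0 else m - 1)"
    proof (cases "odd k")
      case True
      have lt: "f q < f (Suc q)" using False True by auto
      moreover have "f q < f (i k)" using lt fq val[of k] True by auto
      ultimately obtain d where d: "d \<in> {i k..Suc q}" "f d = 0"
        using fold_mapD(9)[OF f ik _ Suc.prems] by auto
      have "d \<le> q" using d lt by (auto simp: le_Suc_eq)
      then have "f q \<le> f d" using monotone_onD[OF dir(1)[OF True], of d q] d by simp
      then show ?thesis using d True by simp
    next
      case even: False
      have lt: "f (Suc q) < f q" using False even by auto
      moreover have "f (i k) < f q" using lt val[of k] even by auto
      ultimately obtain d where d: "d \<in> {i k..Suc q}" "f d = m - 1"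
        using fold_mapD(10)[OF f ik _ Suc.prems] by auto
      have "d \<le> q" using d lt fq by (auto simp: le_Suc_eq)
      then have "f d \<le> f q" using monotone_onD[of "{i k..q}" _ _ f d q] dir(2) even d by simp
      then show ?thesis using d even fq by simp
    qed
    define i' where "i' = i(Suc k := q)"
    have old: "i' j = i j" if "j \<le> k" for j using that by (simp add: i'_def)
    have lt: "i k < q"
    proof -
      have "f q \<noteq> f (i k)" using ext val[of k] fold_mapD(2)[OF f] by auto
      then show ?thesis using ik by (cases "i k = q") auto
    qed
    have "turning_points m f (Suc q) (Suc k) i'"
      unfolding turning_points_def
    proof (intro conjI)
      show "\<forall>j<Suc k. i' j < i' (Suc j)"
        using inc lt by (auto simp: less_Suc_eq i'_def)
      show "\<forall>j<Suc k. mono_on {i' j..i' (Suc j)} f \<or> antimono_on {i' j..i' (Suc j)} f"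
        using mon dir by (auto simp: less_Suc_eq i'_def split: if_splits)
      show "\<forall>j\<le>Suc k. f (i' j) = (if odd j then m - 1 else 0)"
        using val ext by (auto simp: le_Suc_eq i'_def)
      show "odd (Suc k) \<longrightarrow> antimono_on {i' (Suc k)..Suc q} f"
        "even (Suc k) \<longrightarrow> mono_on {i' (Suc k)..Suc q} f"
        using False by (auto simp: i'_def monotone_on_def le_Suc_eq)
      show "Suc k = 0 \<or> f (Suc q) \<noteq> f (i' (Suc k))"
        using False by (auto simp: i'_def split: if_splits)
    qed (use i0 in \<open>auto simp: i'_def\<close>)
    then show ?thesis by blast
  qed
qed

text \<open>The right end \<open>n - 1\<close> closes the last monotone piece, because it is sent to an extreme value other
  than that at the last turning point.\<close>

lemma fold_map_imp_lin_mor: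
  assumes f: "fold_map n m f"
  shows "lin_mor n m f"
proof -
  note nm = fold_mapD(1,2)[OF f]
  obtain top where top: "top < n" "f top = m - 1" using fold_mapD(6)[OF f] by blast
  have img: "f ` {..<n} = {..<m}"
  proof
    show "f ` {..<n} \<subseteq> {..<m}" using fold_mapD(5)[OF f] by auto
    show "{..<m} \<subseteq> f ` {..<n}"
    proof
      fix j assume "j \<in> {..<m}"
      then have "j \<le> f top" using top by simp
      then obtain d where "d \<le> top" "f d = j"
        using fold_map_intermediate_value[OF f, of 0 top j] fold_mapD(3)[OF f] top nm by auto
      then show "j \<in> f ` {..<n}" using top by force
    qed
  qed
  have edge: "\<exists>w. Suc w < n \<and> f w = j \<and> f (Suc w) = Suc j" if "Suc j < m" for j
  proof -
    define w where "w = (LEAST v. Suc j \<le> f v)"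
    have "Suc j \<le> f w" unfolding w_def by (rule LeastI[of _ top]) (use that top in auto)
    moreover have wn: "w \<le> top" unfolding w_def by (rule Least_le) (use that top in auto)
    moreover obtain w' where w': "w = Suc w'"
      using \<open>Suc j \<le> f w\<close> fold_mapD(3)[OF f] by (cases w) auto
    moreover have "f w' \<le> j"
      using not_less_Least[of w' "\<lambda>v. Suc j \<le> f v"] w' by (simp add: w_def)
    ultimately show ?thesis
      using fold_mapD(7)[OF f, of w'] top by (intro exI[of _ w']) auto
  qed
  have edg: "map_prod f f ` lin_edges n = lin_edges m"
  proof
    show "map_prod f f ` lin_edges n \<subseteq> lin_edges m"
    proof (rule image_subsetI)
      fix e assume "e \<in> lin_edges n"
      then obtain a b where e: "e = (a, b)" and ab: "(a, b) \<in> lin_edges n" by (cases e) auto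
      then consider "a = b" | "b = Suc a" | "a = Suc b" by (force simp: lin_edges_def)
      then show "map_prod f f e \<in> lin_edges m"
        unfolding e using fold_mapD(5)[OF f] fold_mapD(7,8)[OF f, of a] fold_mapD(7,8)[OF f, of b] ab
        by cases (auto simp: lin_edges_def)
    qed
    show "lin_edges m \<subseteq> map_prod f f ` lin_edges n"
    proof clarify
      fix a b assume ab: "(a, b) \<in> lin_edges m"
      then consider "a = b" | "b = Suc a" | "a = Suc b" by (force simp: lin_edges_def)
      then show "(a, b) \<in> map_prod f f ` lin_edges n"
      proof cases
        case 1
        have "a \<in> f ` {..<n}" using img ab by (auto simp: lin_edges_def)
        then obtain v where "v < n" "f v = a" by auto
        then show ?thesis using 1 by (intro image_eqI[of _ _ "(v, v)"]) (auto simp: lin_edges_def)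
      next
        case 2
        then obtain w where "Suc w < n" "f w = a" "f (Suc w) = Suc a"
          using edge[of a] ab by (auto simp: lin_edges_def)
        then show ?thesis using 2
          by (intro image_eqI[of _ _ "(w, Suc w)"]) (auto simp: lin_edges_def)
      next
        case 3
        then obtain w where "Suc w < n" "f w = b" "f (Suc w) = Suc b"
          using edge[of b] ab by (auto simp: lin_edges_def)
        then show ?thesis using 3
          by (intro image_eqI[of _ _ "(Suc w, w)"]) (auto simp: lin_edges_def)
      qed
    qed
  qed
  obtain k i where tp: "turning_points m f (n - 1) k i"
    using fold_map_turning_points[OF f, of "n - 1"] nm by auto
  note i0 = turning_pointsD(1)[OF tp] and ik = turning_pointsD(2)[OF tp]
    and inc = turning_pointsD(3)[OF tp] and mon = turning_pointsD(4)[OF tp]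
    and val = turning_pointsD(5)[OF tp] and dir = turning_pointsD(6,7)[OF tp]
    and ne = turning_pointsD(8)[OF tp]
  have last: "f (n - 1) \<noteq> f (i k)"
  proof (cases "k = 0")
    case True
    then have "mono_on {0..n - 1} f" using dir(2) i0 by simp
    from mono_onD[OF this, of top "n - 1"] have "f top \<le> f (n - 1)" using top by auto
    then show ?thesis using True i0 top nm fold_mapD(3)[OF f] by auto
  qed (use ne in simp)
  have lt: "i k < n - 1" using last ik by (cases "i k = n - 1") auto
  have lv: "f (n - 1) = (if odd (Suc k) then m - 1 else 0)"
    using last fold_mapD(4)[OF f] val[of k] by (cases "odd k") auto
  define i' where "i' = i(Suc k := n - 1)"
  have "i' 0 = 0 \<and> i' (Suc k) = n - 1 \<and> (\<forall>j<Suc k. i' j < i' (Suc j)) \<and>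
     (\<forall>j<Suc k. mono_on {i' j..i' (Suc j)} f \<or> antimono_on {i' j..i' (Suc j)} f) \<and>
     (\<forall>j\<le>Suc k. f (i' j) = (if odd j then m - 1 else 0))"
  proof (intro conjI)
    show "\<forall>j<Suc k. i' j < i' (Suc j)"
      using inc lt by (auto simp: less_Suc_eq i'_def)
    show "\<forall>j<Suc k. mono_on {i' j..i' (Suc j)} f \<or> antimono_on {i' j..i' (Suc j)} f"
      using mon dir by (auto simp: less_Suc_eq i'_def split: if_splits)
    show "\<forall>j\<le>Suc k. f (i' j) = (if odd j then m - 1 else 0)"
      using val lv by (auto simp: le_Suc_eq i'_def)
  qed (use i0 in \<open>auto simp: i'_def\<close>)
  then show ?thesis
    unfolding lin_mor_def lin_epi_def using nm img edg fold_mapD(3)[OF f] by blast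
qed

lemma lin_mor_iff_fold_map: "lin_mor n m f \<longleftrightarrow> fold_map n m f"
  using lin_mor_imp_fold_map fold_map_imp_lin_mor by blast

text \<open>If \<open>g \<circ> f\<close> has a valley at \<open>b\<close> and \<open>f b\<close> lies between \<open>f a\<close> and \<open>f c\<close>, then \<open>g\<close> has a valley at \<open>f b\<close>
  and the zero of \<open>g\<close> that it touches is a value of \<open>f\<close> on \<open>{a..c}\<close> by the intermediate value property.
  Otherwise \<open>f\<close> itself has a valley or a peak at \<open>b\<close> and reaches an end of its range, where \<open>g\<close> is either
  \<open>0\<close> or the top; in the latter case that end takes over the role of \<open>f a\<close> or \<open>f c\<close>.\<close>

lemma fold_map_comp:
  assumes f: "fold_map n m f" and g: "fold_map m l g"
  shows "fold_map n l (\<lambda>v. g (f v))"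
proof -
  note F = fold_mapD[OF f] and G = fold_mapD[OF g]
  obtain top where top: "top < m" "g top = l - 1" using G(6) by blast
  obtain mx where mx: "mx < n" "f mx = m - 1" using F(6) by blast
  have hit: "\<exists>v\<in>{a..c}. f v = d"
    if "c < n" "x \<in> {a..c}" "y \<in> {a..c}" "d \<in> {f x..f y}" for a c x y d
  proof -
    have "x < n" "y < n" "f x \<le> d" "d \<le> f y" using that by auto
    from fold_map_intermediate_value[OF f this]
    obtain v where v: "v \<in> {min x y..max x y}" "f v = d" by blast
    have "{min x y..max x y} \<subseteq> {a..c}" using that(2,3) by (auto simp: min_def max_def)
    then show ?thesis using v by blast
  qed
  have valley: "\<exists>d\<in>{a..c}. g (f d) = 0"
    if abc: "a \<le> b" "b \<le> c" "c < n" "g (f b) < g (f a)" "g (f b) < g (f c)" for a b c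
  proof -
    \<comment> \<open>A valley of \<open>g\<close> at \<open>f b\<close> between two values of \<open>f\<close> is pulled back to \<open>{a..c}\<close>.\<close>
    have pull: ?thesis
      if xy: "x \<in> {a..c}" "y \<in> {a..c}" "f x \<le> f b" "f b \<le> f y" "g (f b) < g (f x)" "g (f b) < g (f y)" for x y
    proof -
      have "f y < m" using F(5)[of y] xy abc by auto
      then obtain d where "d \<in> {f x..f y}" "g d = 0" using G(9)[OF xy(3,4)] xy by auto
      then show ?thesis using hit[OF abc(3) xy(1,2)] by blast
    qed
    have ne: "f b \<noteq> f a" "f b \<noteq> f c" using abc by auto
    consider "f a < f b \<and> f b < f c" | "f c < f b \<and> f b < f a" | "f b < f a \<and> f b < f c"
      | "f a < f b \<and> f c < f b" using ne by linarith
    then show ?thesis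
    proof cases
      case 1 then show ?thesis using pull[of a c] abc by auto
    next
      case 2 then show ?thesis using pull[of c a] abc by auto
    next
      case 3
      then obtain d where "d \<in> {a..c}" "f d = 0" using F(9)[OF abc(1-3)] by blast
      then show ?thesis using G(3) by (intro bexI[of _ d]) auto
    next
      case 4
      then obtain d where d: "d \<in> {a..c}" "f d = m - 1" using F(10)[OF abc(1-3)] by blast
      show ?thesis
      proof (cases "g (m - 1) = 0")
        case False
        have "f a < m" using F(5)[of a] abc by simp
        then have "g (f b) < l - 1" using abc G(5)[of "f a"] by linarith
        then show ?thesis
          using pull[of a d] d 4 abc False G(4) F(5)[of b] by auto
      qed (use d in \<open>intro bexI[of _ d]; auto\<close>)
    qed
  qed
  have peak: "\<exists>d\<in>{a..c}. g (f d) = l - 1"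
    if abc: "a \<le> b" "b \<le> c" "c < n" "g (f a) < g (f b)" "g (f c) < g (f b)" for a b c
  proof -
    have pull: ?thesis
      if xy: "x \<in> {a..c}" "y \<in> {a..c}" "f x \<le> f b" "f b \<le> f y" "g (f x) < g (f b)" "g (f y) < g (f b)" for x y
    proof -
      have "f y < m" using F(5)[of y] xy abc by auto
      then obtain d where "d \<in> {f x..f y}" "g d = l - 1" using G(10)[OF xy(3,4)] xy by auto
      then show ?thesis using hit[OF abc(3) xy(1,2)] by blast
    qed
    have ne: "f b \<noteq> f a" "f b \<noteq> f c" using abc by auto
    consider "f a < f b \<and> f b < f c" | "f c < f b \<and> f b < f a" | "f b < f a \<and> f b < f c"
      | "f a < f b \<and> f c < f b" using ne by linarith
    then show ?thesis
    proof cases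
      case 1 then show ?thesis using pull[of a c] abc by auto
    next
      case 2 then show ?thesis using pull[of c a] abc by auto
    next
      case 3
      then obtain d where "d \<in> {a..c}" "f d = 0" using F(9)[OF abc(1-3)] by blast
      then show ?thesis using pull[of d a] 3 abc G(3) by auto
    next
      case 4
      then obtain d where d: "d \<in> {a..c}" "f d = m - 1" using F(10)[OF abc(1-3)] by blast
      show ?thesis
      proof (cases "g (m - 1) = l - 1")
        case False
        then show ?thesis
          using pull[of a d] d 4 abc G(4) F(5)[of b] by auto
      qed (use d in \<open>intro bexI[of _ d]; auto\<close>)
    qed
  qed
  have lip: "g (f (Suc v)) \<le> Suc (g (f v)) \<and> g (f v) \<le> Suc (g (f (Suc v)))" if v: "Suc v < n" for v
  proof -
    have "f v < m" "f (Suc v) < m" using F(5) v by auto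
    consider "f (Suc v) = f v" | "f (Suc v) = Suc (f v)" | "f v = Suc (f (Suc v))"
      using F(7,8)[OF v] by linarith
    then show ?thesis
    proof cases
      case 1 then show ?thesis by simp
    next
      case 2 then show ?thesis using G(7,8)[of "f v"] \<open>f (Suc v) < m\<close> by simp
    next
      case 3 then show ?thesis using G(7,8)[of "f (Suc v)"] \<open>f v < m\<close> by simp
    qed
  qed
  have "\<exists>v<n. g (f v) = l - 1"
  proof -
    have "top \<le> f mx" using top mx by simp
    then obtain v where "v \<in> {0..mx}" "f v = top"
      using hit[of mx 0 0 mx top] mx top F(3) by auto
    then show ?thesis using mx top by (intro exI[of _ v]) auto
  qed
  moreover have "g (f (n - 1)) \<in> {0, l - 1}" using F(4) G(3,4) by auto
  moreover have "\<forall>v<n. g (f v) < l" using F(5) G(5) by blast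
  moreover have "g (f 0) = 0" using F(3) G(3) by simp
  ultimately show ?thesis
    unfolding fold_map_def using F(1) G(2) lip valley peak by blast
qed

lemma lin_mor_comp: "lin_mor n m f \<Longrightarrow> lin_mor m l g \<Longrightarrow> lin_mor n l (\<lambda>v. g (f v))"
  by (simp add: lin_mor_iff_fold_map fold_map_comp)

lemma lin_mor_id: "2 \<le> n \<Longrightarrow> lin_mor n n (\<lambda>v. v)"
  by (auto simp: lin_mor_iff_fold_map fold_map_def intro: exI[of _ "n - 1"])

text \<open>Every vertex of \<open>\<langle>a\<rangle>\<close> is doubled. Vertices of \<open>\<langle>2 * a\<rangle>\<close> at distance at most \<open>2\<close> have images at
  distance at most \<open>1\<close>; this is what makes the edge relation of the limit transitive.\<close>

lemma lin_mor_halving: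
  assumes "2 \<le> a"
  shows "lin_mor (2 * a) a (\<lambda>v. v div 2)"
proof -
  have "\<not> (b div 2 < a' div 2)" if "a' \<le> b" for a' b :: nat
    using that div_le_mono[OF that, of 2] by simp
  moreover have "(2 * a - 1) div 2 = a - 1" by auto
  ultimately show ?thesis
    unfolding lin_mor_iff_fold_map fold_map_def using assms
    by (auto intro!: exI[of _ "2 * a - 1"])
qed

section \<open>Threads of inverse sequences\<close>

primrec bond :: "(nat \<Rightarrow> 'a \<Rightarrow> 'a) \<Rightarrow> nat \<Rightarrow> nat \<Rightarrow> 'a \<Rightarrow> 'a" where
  "bond b n 0 y = y"
| "bond b n (Suc k) y = bond b n k (b (n + k) y)"

lemma bond_thread:
  assumes "\<And>n. b n (x (Suc n)) = x n"
  shows "bond b n k (x (n + k)) = x n"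
  by (induction k) (simp_all add: assms)

lemma threads_determined_below:
  assumes "\<And>n. b n (x (Suc n)) = x n" "\<And>n. b n (y (Suc n)) = y n" "x m = y m" "n \<le> m"
  shows "x n = y n"
  using bond_thread[of b x n "m - n"] bond_thread[of b y n "m - n"] assms by simp

text \<open>The later coordinates come from successive choices of preimages, the earlier ones from the bonding maps.
  With pairs as elements this lifts edges as well as vertices.\<close>

lemma thread_through:
  assumes surj: "\<And>n. b n ` A (Suc n) = A n" and y: "y \<in> A m"
  shows "\<exists>x. (\<forall>n. x n \<in> A n) \<and> (\<forall>n. b n (x (Suc n)) = x n) \<and> x m = y"
proof -
  have "\<exists>z. z \<in> A (Suc n) \<and> b n z = w" if "w \<in> A n" for n w
  proof -
    have "w \<in> b n ` A (Suc n)" using that surj by simp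
    then show ?thesis by auto
  qed
  then have "\<forall>n w. \<exists>z. w \<in> A n \<longrightarrow> z \<in> A (Suc n) \<and> b n z = w" by blast
  then obtain lift where "\<forall>n w. w \<in> A n \<longrightarrow> lift n w \<in> A (Suc n) \<and> b n (lift n w) = w"
    unfolding choice_iff by blast
  then have lift: "\<And>n w. w \<in> A n \<Longrightarrow> lift n w \<in> A (Suc n) \<and> b n (lift n w) = w" by blast
  define up where "up = rec_nat y (\<lambda>k w. lift (m + k) w)"
  have up0: "up 0 = y" and upS: "\<And>k. up (Suc k) = lift (m + k) (up k)" by (simp_all add: up_def)
  have upA: "up k \<in> A (m + k)" for k
    by (induction k) (use y lift in \<open>auto simp: up0 upS\<close>)
  have upb: "b (m + k) (up (Suc k)) = up k" for k using lift upA by (simp add: upS)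
  have bondA: "bond b n k w \<in> A n" if "w \<in> A (n + k)" for n k w
    using that
  proof (induction k arbitrary: w)
    case (Suc k)
    then have "b (n + k) w \<in> A (n + k)" using surj[of "n + k"] by auto
    then show ?case using Suc.IH by simp
  qed simp
  have bond_step: "b n (bond b (Suc n) k w) = bond b n (Suc k) w" for n k w
    by (induction k arbitrary: w) simp_all
  define x where "x n = (if m \<le> n then up (n - m) else bond b n (m - n) y)" for n
  have "x n \<in> A n" for n
    using upA[of "n - m"] bondA[of y n "m - n"] y by (cases "m \<le> n") (simp_all add: x_def)
  moreover have "b n (x (Suc n)) = x n" for n
  proof -
    consider "m \<le> n" | "Suc n = m" | "Suc n < m" by linarith
    then show ?thesis
    proof cases
      case 1
      then show ?thesis using upb[of "n - m"] by (simp add: x_def Suc_diff_le)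
    next
      case 2
      then show ?thesis by (auto simp: x_def up0)
    next
      case 3
      then show ?thesis using bond_step[of n "m - Suc n" y] by (simp add: x_def Suc_diff_Suc)
    qed
  qed
  ultimately show ?thesis by (intro exI[of _ x]) (simp add: x_def up0)
qed

lemma lim_pts_iff: "x \<in> lim_pts L \<longleftrightarrow> (\<forall>n. x n < fst L n) \<and> (\<forall>n. snd L n (x (Suc n)) = x n)"
  by (auto simp: lim_top_def topspace_invlim)

context
  fixes K :: lin_seq
  assumes K: "is_lin_seq K"
begin

lemma lin_seq_mor: "lin_mor (fst K (Suc n)) (fst K n) (snd K n)"
  using K by (simp add: is_lin_seq_def)

lemma lin_seq_size: "2 \<le> fst K n"
  using lin_seq_mor[of n] by (simp add: lin_mor_def)

lemma lin_mor_bond: "lin_mor (fst K (n + k)) (fst K n) (bond (snd K) n k)"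
proof (induction k)
  case 0
  then show ?case using lin_mor_id[OF lin_seq_size] by (simp add: bond.simps(1)[abs_def])
next
  case (Suc k)
  show ?case using lin_mor_comp[OF lin_seq_mor[of "n + k"] Suc.IH] by (simp add: bond.simps(2)[abs_def])
qed

lemma lim_pts_through:
  assumes "v < fst K m"
  shows "\<exists>x\<in>lim_pts K. x m = v"
proof -
  have "snd K n ` {..<fst K (Suc n)} = {..<fst K n}" for n
    using lin_seq_mor[of n] by (simp add: lin_mor_def lin_epi_def)
  from thread_through[of "snd K" "\<lambda>n. {..<fst K n}", OF this, of v m] assms
  show ?thesis by (auto simp: lim_pts_iff)
qed

lemma lim_rel_through:
  assumes "(v, w) \<in> lin_edges (fst K m)"
  shows "\<exists>x y. (x, y) \<in> lim_rel K \<and> x m = v \<and> y m = w"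
proof -
  have "map_prod (snd K n) (snd K n) ` lin_edges (fst K (Suc n)) = lin_edges (fst K n)" for n
    using lin_seq_mor[of n] by (simp add: lin_mor_def lin_epi_def)
  from thread_through[of "\<lambda>n. map_prod (snd K n) (snd K n)" "\<lambda>n. lin_edges (fst K n)", OF this assms]
  obtain z where z: "\<And>n. z n \<in> lin_edges (fst K n)" "z m = (v, w)"
    "\<And>n. map_prod (snd K n) (snd K n) (z (Suc n)) = z n" by blast
  have "snd K n (fst (z (Suc n))) = fst (z n)" "snd K n (snd (z (Suc n))) = snd (z n)" for n
    using z(3)[of n] by (metis fst_map_prod, metis snd_map_prod)
  moreover have "fst (z n) < fst K n" "snd (z n) < fst K n" for n
    using z(1)[of n] by (auto simp: lin_edges_def)
  ultimately have "(\<lambda>n. fst (z n), \<lambda>n. snd (z n)) \<in> lim_rel K"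
    using z(1) by (simp add: lim_rel_def lim_pts_iff)
  then show ?thesis using z(2) by force
qed

end

section \<open>Homogeneity of the limit\<close>

text \<open>A morphism from the limit to \<open>\<langle>a\<rangle>\<close>. Keeping one value instead of a constant sequence of values
  avoids the passage through \<open>const_seq\<close>.\<close>

definition level_mor :: "lin_seq \<Rightarrow> nat \<Rightarrow> ((nat \<Rightarrow> nat) \<Rightarrow> nat) \<Rightarrow> bool" where
  "level_mor K a u \<longleftrightarrow>
     (\<exists>i u'. lin_mor (fst K i) a u' \<and> (\<forall>x\<in>lim_pts K. u x = u' (x i)))"

lemma level_mor_late:
  assumes K: "is_lin_seq K" and u: "level_mor K a u"
  shows "\<exists>i u'. j \<le> i \<and> lin_mor (fst K i) a u' \<and> (\<forall>x\<in>lim_pts K. u x = u' (x i))"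
proof -
  obtain i u' where i: "lin_mor (fst K i) a u'" "\<And>x. x \<in> lim_pts K \<Longrightarrow> u x = u' (x i)"
    using u unfolding level_mor_def by blast
  have "u x = u' (bond (snd K) i j (x (i + j)))" if "x \<in> lim_pts K" for x
    using bond_thread[of "snd K" x i j] that i(2) by (simp add: lim_pts_iff)
  then show ?thesis
    using lin_mor_comp[OF lin_mor_bond[OF K, of i j] i(1)] by (metis le_add2)
qed

lemma level_mor_imp_lim_mor:
  assumes K: "is_lin_seq K" and u: "level_mor K a u"
  shows "lim_mor K (const_seq a) (\<lambda>x n. u x)"
proof -
  obtain i u' where i: "lin_mor (fst K i) a u'" "\<And>x. x \<in> lim_pts K \<Longrightarrow> u x = u' (x i)"
    using u unfolding level_mor_def by blast
  have "u x < a" if "x \<in> lim_pts K" for x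
    using that i lin_mor_imp_fold_map[OF i(1)] fold_mapD(5) by (simp add: lim_pts_iff)
  moreover have "u x = u' (bond (snd K) i n (x (i + n)))" if "x \<in> lim_pts K" for x n
    using bond_thread[of "snd K" x i n] that i(2) by (simp add: lim_pts_iff)
  moreover have "strict_mono (\<lambda>n. i + n)" by (simp add: strict_mono_def)
  moreover have "lin_mor (fst K (i + n)) a (\<lambda>v. u' (bond (snd K) i n v))" for n
    using lin_mor_comp[OF lin_mor_bond[OF K] i(1)] .
  ultimately show ?thesis
    unfolding lim_mor_def
    by (intro conjI exI[of _ "\<lambda>n. i + n"] exI[of _ "\<lambda>n v. u' (bond (snd K) i n v)"] allI ballI)
      (simp_all add: lim_pts_iff const_seq_def image_subset_iff)
qed

lemma level_mor_projection:
  assumes "is_lin_seq K"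
  shows "level_mor K (fst K m) (\<lambda>x. x m)"
  unfolding level_mor_def using lin_mor_id[OF lin_seq_size[OF assms]]
  by (intro exI[of _ m] exI[of _ "\<lambda>v. v"]) auto

lemma fraisse_limit_lin_seq: "fraisse_limit K \<Longrightarrow> is_lin_seq K"
  by (simp add: fraisse_limit_def)

lemma level_mor_lift:
  assumes K: "fraisse_limit K" and u: "level_mor K a u" and g: "lin_mor b a g"
  shows "\<exists>v. level_mor K b v \<and> (\<forall>x\<in>lim_pts K. g (v x) = u x)"
proof -
  have ab: "2 \<le> a" "2 \<le> b" and gr: "\<And>v. v < b \<Longrightarrow> g v < a"
    using lin_mor_imp_fold_map[OF g] by (auto dest: fold_mapD)
  have "lim_mor (const_seq b) (const_seq a) (\<lambda>y n. g (y n))"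
    unfolding lim_mor_def
  proof (intro conjI exI[of _ "\<lambda>n. n"] exI[of _ "\<lambda>n. g"] allI ballI)
    show "(\<lambda>y n. g (y n)) ` lim_pts (const_seq b) \<subseteq> lim_pts (const_seq a)"
      using gr by (auto simp: lim_pts_iff const_seq_def)
  qed (use g in \<open>simp_all add: const_seq_def strict_mono_def\<close>)
  moreover have "\<forall>f g. lim_mor K (const_seq a) f \<longrightarrow> lim_mor (const_seq b) (const_seq a) g \<longrightarrow>
        (\<exists>h. lim_mor K (const_seq b) h \<and> (\<forall>x\<in>lim_pts K. g (h x) = f x))"
    using K ab unfolding fraisse_limit_def by simp
  ultimately obtain h where h: "lim_mor K (const_seq b) h"
      "\<And>x. x \<in> lim_pts K \<Longrightarrow> (\<lambda>n. g (h x n)) = (\<lambda>n. u x)"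
    using level_mor_imp_lim_mor[OF fraisse_limit_lin_seq[OF K] u] by blast
  have "level_mor K b (\<lambda>x. h x 0)"
    using h(1) unfolding lim_mor_def level_mor_def const_seq_def fst_conv by blast
  moreover have "g (h x 0) = u x" if "x \<in> lim_pts K" for x
    using fun_cong[OF h(2)[OF that], of 0] .
  ultimately show ?thesis by blast
qed

text \<open>A family of morphisms from the levels \<open>i n\<close> to the levels \<open>m n\<close> has a limit if it is compatible. The hypothesis \<open>compat\<close> expresses
  compatibility through threads: whenever \<open>y\<close> continues the image of \<open>x\<close> at level \<open>m (Suc n)\<close>, it also
  passes through the image of \<open>x\<close> at level \<open>m n\<close>. Proofs can then follow one thread \<open>y\<close> down
  instead of computing with composites of bonding maps.\<close>

lemma lim_mor_of_levels:
  fixes \<alpha> :: "nat \<Rightarrow> nat \<Rightarrow> nat"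
  assumes K: "is_lin_seq K" and m: "\<And>n. n \<le> m n" and i: "strict_mono i"
    and \<alpha>: "\<And>n. lin_mor (fst K (i n)) (fst K (m n)) (\<alpha> n)"
    and compat: "\<And>x y n. x \<in> lim_pts K \<Longrightarrow> y \<in> lim_pts K \<Longrightarrow>
      y (m (Suc n)) = \<alpha> (Suc n) (x (i (Suc n))) \<Longrightarrow> y (m n) = \<alpha> n (x (i n))"
  shows "\<exists>h. lim_mor K K h \<and> (\<forall>x\<in>lim_pts K. \<forall>n. h x (m n) = \<alpha> n (x (i n)))"
proof -
  define h where "h x n = bond (snd K) n (m n - n) (\<alpha> n (x (i n)))" for x :: "nat \<Rightarrow> nat" and n
  \<comment> \<open>Each coordinate of \<open>h x\<close> is read off from a thread through the prescribed value at level \<open>m n\<close>.\<close>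
  have lift: "\<exists>y\<in>lim_pts K. y (m n) = \<alpha> n (x (i n)) \<and> y n = h x n" if x: "x \<in> lim_pts K" for x n
  proof -
    have "x (i n) < fst K (i n)" using x by (simp add: lim_pts_iff)
    then have "\<alpha> n (x (i n)) < fst K (m n)"
      using fold_mapD(5)[OF lin_mor_imp_fold_map[OF \<alpha>]] by blast
    then obtain y where y: "y \<in> lim_pts K" "y (m n) = \<alpha> n (x (i n))"
      using lim_pts_through[OF K] by metis
    then have "h x n = y n"
      using bond_thread[of "snd K" y n "m n - n"] m[of n] by (simp add: h_def lim_pts_iff)
    then show ?thesis using y by auto
  qed
  have down: "y (m n) = \<alpha> n (x (i n))"
    if "x \<in> lim_pts K" "y \<in> lim_pts K" "y (m N) = \<alpha> N (x (i N))" "n \<le> N" for x y n N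
    using that(4)
  proof (induction n rule: inc_induct)
    case (step n)
    then show ?case using compat that(1,2) by blast
  qed (use that in simp)
  have h_val: "h x (m n) = \<alpha> n (x (i n))" if x: "x \<in> lim_pts K" for x n
  proof -
    obtain y where "y \<in> lim_pts K" "y (m (m n)) = \<alpha> (m n) (x (i (m n)))" "y (m n) = h x (m n)"
      using lift[OF x, of "m n"] by blast
    then show ?thesis using down[OF x, of y "m n" n] m[of n] by simp
  qed
  have mor: "lin_mor (fst K (i n)) (fst K n) (\<lambda>v. bond (snd K) n (m n - n) (\<alpha> n v))" for n
    using lin_mor_comp[OF \<alpha>[of n], of "fst K n" "bond (snd K) n (m n - n)"]
      lin_mor_bond[OF K, of n "m n - n"] m[of n] by simp
  have pts: "h x \<in> lim_pts K" if x: "x \<in> lim_pts K" for x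
    unfolding lim_pts_iff
  proof (intro conjI allI)
    fix n
    obtain y where y: "y \<in> lim_pts K" "y (m (Suc n)) = \<alpha> (Suc n) (x (i (Suc n)))" "y (Suc n) = h x (Suc n)"
      using lift[OF x] by blast
    have "y (m n) = \<alpha> n (x (i n))" using compat[OF x y(1,2)] .
    then have "h x n = y n"
      using bond_thread[of "snd K" y n "m n - n"] m[of n] y(1) by (simp add: h_def lim_pts_iff)
    then show "h x n < fst K n" "snd K n (h x (Suc n)) = h x n"
      using y(1) by (simp_all add: lim_pts_iff y(3)[symmetric])
  qed
  have "lim_mor K K h"
    unfolding lim_mor_def using pts mor i
    by (intro conjI exI[of _ i] exI[of _ "\<lambda>n v. bond (snd K) n (m n - n) (\<alpha> n v)"]) (auto simp: h_def)
  then show ?thesis using h_val by blast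
qed

text \<open>Lifting the projection to level \<open>m\<close> along \<open>\<alpha>\<close> gives \<open>\<beta>\<close>, and lifting the projection to level \<open>i\<close> along \<open>\<beta>\<close>
  gives \<open>\<alpha>'\<close>. Thus \<open>\<alpha>\<close> and \<open>\<beta>\<close> are inverse to each other up to bonding maps.\<close>

lemma back_and_forth_step:
  assumes K: "fraisse_limit K" and \<alpha>: "lin_mor (fst K i) (fst K m) \<alpha>"
  shows "\<exists>m' i' \<alpha>' \<beta>. m < m' \<and> i < i' \<and> lin_mor (fst K i') (fst K m') \<alpha>' \<and>
    lin_mor (fst K m') (fst K i) \<beta> \<and>
    (\<forall>x\<in>lim_pts K. \<alpha> (\<beta> (x m')) = x m) \<and> (\<forall>x\<in>lim_pts K. \<beta> (\<alpha>' (x i')) = x i)"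
proof -
  note S = fraisse_limit_lin_seq[OF K]
  have lift: "\<exists>j' \<gamma>'. j < j' \<and> lin_mor (fst K j') b \<gamma>' \<and> (\<forall>x\<in>lim_pts K. \<gamma> (\<gamma>' (x j')) = x l)"
    if \<gamma>: "lin_mor b (fst K l) \<gamma>" for b l j \<gamma>
  proof -
    obtain v where v: "level_mor K b v" "\<And>x. x \<in> lim_pts K \<Longrightarrow> \<gamma> (v x) = x l"
      using level_mor_lift[OF K level_mor_projection[OF S] \<gamma>] by blast
    obtain j' v' where j': "Suc j \<le> j'" "lin_mor (fst K j') b v'" "\<And>x. x \<in> lim_pts K \<Longrightarrow> v x = v' (x j')"
      using level_mor_late[OF S v(1)] by blast
    have "\<gamma> (v' (x j')) = x l" if "x \<in> lim_pts K" for x using v(2) j'(3) that by simp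
    then show ?thesis using j'(1,2) by (intro exI[of _ j'] exI[of _ v']) auto
  qed
  obtain m' \<beta> where \<beta>: "m < m'" "lin_mor (fst K m') (fst K i) \<beta>" "\<forall>x\<in>lim_pts K. \<alpha> (\<beta> (x m')) = x m"
    using lift[OF \<alpha>] by blast
  obtain i' \<alpha>' where "i < i'" "lin_mor (fst K i') (fst K m') \<alpha>'" "\<forall>x\<in>lim_pts K. \<beta> (\<alpha>' (x i')) = x i"
    using lift[OF \<beta>(2)] by blast
  then show ?thesis using \<beta> by blast
qed

text \<open>Back-and-forth: the extension property first yields some \<open>\<alpha>\<close> on a finite level that carries \<open>v\<close> to \<open>u\<close>.
  Iterating the step above from \<open>\<alpha>\<close> gives two interleaved compatible families, whose limits
  are inverse to each other.\<close>

theorem fraisse_limit_homogeneous: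
  assumes K: "fraisse_limit K" and u: "level_mor K a u" and v: "level_mor K a v"
  shows "\<exists>h\<in>lim_Aut K. \<forall>x\<in>lim_pts K. u (h x) = v x"
proof -
  note S = fraisse_limit_lin_seq[OF K]
  obtain m0 u' where u': "lin_mor (fst K m0) a u'" "\<And>x. x \<in> lim_pts K \<Longrightarrow> u x = u' (x m0)"
    using u unfolding level_mor_def by blast
  obtain w where w: "level_mor K (fst K m0) w" "\<And>x. x \<in> lim_pts K \<Longrightarrow> u' (w x) = v x"
    using level_mor_lift[OF K v u'(1)] by blast
  obtain i0 \<alpha>0 where \<alpha>0: "lin_mor (fst K i0) (fst K m0) \<alpha>0" "\<And>x. x \<in> lim_pts K \<Longrightarrow> w x = \<alpha>0 (x i0)"
    using w(1) unfolding level_mor_def by blast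
  \<comment> \<open>A state \<open>(m, i, \<alpha>)\<close> is a morphism \<open>\<alpha>\<close> from level \<open>i\<close> to level \<open>m\<close>; the initial one carries \<open>v\<close> to \<open>u\<close>.\<close>
  define P where "P n s \<longleftrightarrow> (case s of (m, i, \<alpha>) \<Rightarrow> lin_mor (fst K i) (fst K m) \<alpha> \<and> n \<le> m \<and> n \<le> i \<and>
      (n = 0 \<longrightarrow> m = m0 \<and> (\<forall>x\<in>lim_pts K. u' (\<alpha> (x i)) = v x)))"
    for n :: nat and s :: "nat \<times> nat \<times> (nat \<Rightarrow> nat)"
  define Q where "Q s s' \<longleftrightarrow> (case s of (m, i, \<alpha>) \<Rightarrow> case s' of (m', i', \<alpha>') \<Rightarrow> m < m' \<and> i < i' \<and>
      (\<exists>\<beta>. lin_mor (fst K m') (fst K i) \<beta> \<and>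
        (\<forall>x\<in>lim_pts K. \<alpha> (\<beta> (x m')) = x m) \<and> (\<forall>x\<in>lim_pts K. \<beta> (\<alpha>' (x i')) = x i)))"
    for s s' :: "nat \<times> nat \<times> (nat \<Rightarrow> nat)"
  have "\<exists>s. \<forall>n. P n (s n) \<and> Q (s n) (s (Suc n))"
  proof (rule dependent_nat_choice)
    have "P 0 (m0, i0, \<alpha>0)" using \<alpha>0 w(2) by (simp add: P_def)
    then show "\<exists>s. P 0 s" by blast
  next
    fix s n assume "P n s"
    obtain m i \<alpha> where s: "s = (m, i, \<alpha>)" by (cases s)
    from \<open>P n s\<close> have P: "lin_mor (fst K i) (fst K m) \<alpha>" "n \<le> m" "n \<le> i" by (auto simp: P_def s)
    obtain m' i' \<alpha>' \<beta> where st: "m < m'" "i < i'" "lin_mor (fst K i') (fst K m') \<alpha>'"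
      "lin_mor (fst K m') (fst K i) \<beta>"
      "\<forall>x\<in>lim_pts K. \<alpha> (\<beta> (x m')) = x m" "\<forall>x\<in>lim_pts K. \<beta> (\<alpha>' (x i')) = x i"
      using back_and_forth_step[OF K P(1)] by blast
    have "P (Suc n) (m', i', \<alpha>')" using st P by (simp add: P_def)
    moreover have "Q s (m', i', \<alpha>')" using st by (auto simp: Q_def s)
    ultimately show "\<exists>s'. P (Suc n) s' \<and> Q s s'" by blast
  qed
  then obtain s where sP: "\<And>n. P n (s n)" and sQ: "\<And>n. Q (s n) (s (Suc n))" by blast
  define m where "m n = fst (s n)" for n
  define i where "i n = fst (snd (s n))" for n
  define \<alpha> where "\<alpha> n = snd (snd (s n))" for n
  have s_eq: "s n = (m n, i n, \<alpha> n)" for n by (simp add: m_def i_def \<alpha>_def)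
  have \<alpha>: "lin_mor (fst K (i n)) (fst K (m n)) (\<alpha> n)" and m_ge: "n \<le> m n" and i_ge: "n \<le> i n" for n
    using sP[of n] by (auto simp: P_def s_eq)
  have start: "m 0 = m0" "\<And>x. x \<in> lim_pts K \<Longrightarrow> u' (\<alpha> 0 (x (i 0))) = v x"
    using sP[of 0] by (auto simp: P_def s_eq)
  have "strict_mono m" "strict_mono i"
    using sQ by (auto simp: strict_mono_Suc_iff Q_def s_eq)
  have "\<exists>\<beta>. lin_mor (fst K (m (Suc n))) (fst K (i n)) \<beta> \<and>
        (\<forall>x\<in>lim_pts K. \<alpha> n (\<beta> (x (m (Suc n)))) = x (m n)) \<and>
        (\<forall>x\<in>lim_pts K. \<beta> (\<alpha> (Suc n) (x (i (Suc n)))) = x (i n))" for n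
    using sQ[of n] by (auto simp: Q_def s_eq)
  then obtain \<beta> where \<beta>: "\<And>n. lin_mor (fst K (m (Suc n))) (fst K (i n)) (\<beta> n)"
    "\<And>n x. x \<in> lim_pts K \<Longrightarrow> \<alpha> n (\<beta> n (x (m (Suc n)))) = x (m n)"
    "\<And>n x. x \<in> lim_pts K \<Longrightarrow> \<beta> n (\<alpha> (Suc n) (x (i (Suc n)))) = x (i n)"
    by metis
  have "\<exists>h. lim_mor K K h \<and> (\<forall>x\<in>lim_pts K. \<forall>n. h x (m n) = \<alpha> n (x (i n)))"
  proof (rule lim_mor_of_levels[where m = m and i = i and \<alpha> = \<alpha>, OF S m_ge \<open>strict_mono i\<close> \<alpha>])
    fix x y n
    assume xy: "x \<in> lim_pts K" "y \<in> lim_pts K" "y (m (Suc n)) = \<alpha> (Suc n) (x (i (Suc n)))"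
    then show "y (m n) = \<alpha> n (x (i n))" using \<beta>(2)[OF xy(2), of n] \<beta>(3)[OF xy(1), of n] by simp
  qed
  then obtain h where h: "lim_mor K K h" "\<And>x n. x \<in> lim_pts K \<Longrightarrow> h x (m n) = \<alpha> n (x (i n))"
    by blast
  have "\<exists>h'. lim_mor K K h' \<and> (\<forall>x\<in>lim_pts K. \<forall>n. h' x (i n) = \<beta> n (x (m (Suc n))))"
  proof (rule lim_mor_of_levels[where m = i and i = "\<lambda>n. m (Suc n)" and \<alpha> = \<beta>, OF S i_ge _ \<beta>(1)])
    show "strict_mono (\<lambda>n. m (Suc n))"
      using \<open>strict_mono m\<close> by (simp add: strict_mono_Suc_iff)
  next
    fix x y n
    assume xy: "x \<in> lim_pts K" "y \<in> lim_pts K" "y (i (Suc n)) = \<beta> (Suc n) (x (m (Suc (Suc n))))"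
    then show "y (i n) = \<beta> n (x (m (Suc n)))"
      using \<beta>(3)[OF xy(2), of n] \<beta>(2)[OF xy(1), of "Suc n"] by simp
  qed
  then obtain h' where h': "lim_mor K K h'" "\<And>x n. x \<in> lim_pts K \<Longrightarrow> h' x (i n) = \<beta> n (x (m (Suc n)))"
    by blast
  have hp: "h x \<in> lim_pts K" "h' x \<in> lim_pts K" if "x \<in> lim_pts K" for x
    using that h(1) h'(1) by (auto simp: lim_mor_def)
  have eqI: "x = y" if "x \<in> lim_pts K" "y \<in> lim_pts K" "\<And>n. x (j n) = y (j n)" "\<And>n. n \<le> j n"
    for x y and j :: "nat \<Rightarrow> nat"
  proof
    fix n
    show "x n = y n"
      by (rule threads_determined_below[of "snd K" x y "j n" n]) (use that in \<open>auto simp: lim_pts_iff\<close>)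
  qed
  have "h' (h x) = x" if x: "x \<in> lim_pts K" for x
    by (rule eqI[of _ _ i]) (use x hp h h' \<beta> i_ge in auto)
  moreover have "h (h' x) = x" if x: "x \<in> lim_pts K" for x
    by (rule eqI[of _ _ m]) (use x hp h h' \<beta> m_ge in auto)
  ultimately have "h \<in> lim_Aut K" using h(1) h'(1) by (auto simp: lim_Aut_def)
  moreover have "u (h x) = v x" if "x \<in> lim_pts K" for x
    using u'(2)[OF hp(1)[OF that]] h(2)[OF that, of 0] start that by simp
  ultimately show ?thesis by blast
qed

section \<open>The edge relation of the limit\<close>

text \<open>Lift the projection to level \<open>n\<close> along the halving map. Along \<open>x\<close>, \<open>y\<close>, \<open>z\<close> the lifted value moves by at
  most \<open>1\<close> in each step, hence by at most \<open>2\<close> in total, and its half by at most \<open>1\<close>.\<close>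

lemma trans_lim_rel:
  assumes K: "fraisse_limit K"
  shows "trans (lim_rel K)"
proof (rule transI)
  fix x y z assume xy: "(x, y) \<in> lim_rel K" and yz: "(y, z) \<in> lim_rel K"
  note S = fraisse_limit_lin_seq[OF K]
  have pts: "x \<in> lim_pts K" "y \<in> lim_pts K" "z \<in> lim_pts K" using xy yz by (auto simp: lim_rel_def)
  have "(x n, z n) \<in> lin_edges (fst K n)" for n
  proof -
    obtain v where v: "level_mor K (2 * fst K n) v" "\<And>x. x \<in> lim_pts K \<Longrightarrow> v x div 2 = x n"
      using level_mor_lift[OF K level_mor_projection[OF S] lin_mor_halving[OF lin_seq_size[OF S]]] by blast
    have "\<bar>int (v p) - int (v q)\<bar> \<le> 1" if "(p, q) \<in> lim_rel K" for p q
    proof -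
      have "(\<lambda>n. v p, \<lambda>n. v q) \<in> lim_rel (const_seq (2 * fst K n))"
        using lim_mor_rel[OF level_mor_imp_lim_mor[OF S v(1)] that] .
      then show ?thesis by (auto simp: lim_rel_def lin_edges_def)
    qed
    from this[OF xy] this[OF yz] have "\<bar>int (v x) - int (v z)\<bar> \<le> 2" by linarith
    then have "\<bar>int (v x div 2) - int (v z div 2)\<bar> \<le> 1" by linarith
    then show ?thesis using v(2) pts by (auto simp: lin_edges_def lim_pts_iff)
  qed
  then show "(x, z) \<in> lim_rel K" using pts by (simp add: lim_rel_def)
qed

lemma quot_map_eq:
  assumes K: "fraisse_limit K" and xy: "(x, y) \<in> lim_rel K"
  shows "quot_map K x = quot_map K y"
proof -
  have "sym (lim_rel K)"
    by (auto simp: sym_def lim_rel_def lin_edges_def abs_minus_commute)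
  then show ?thesis
    using trans_lim_rel[OF K] xy unfolding quot_map_def by (auto dest: symD transD)
qed

lemma lim_rel_refl: "x \<in> lim_pts K \<Longrightarrow> (x, x) \<in> lim_rel K"
  by (simp add: lim_rel_def lin_edges_def lim_pts_iff)

lemma lim_rel_of_quot_map_eq:
  assumes "x \<in> lim_pts K" "quot_map K y = quot_map K x"
  shows "(y, x) \<in> lim_rel K"
  using assms lim_rel_refl unfolding quot_map_def by blast

section \<open>Open maps out of inverse limits\<close>

lemma cont_open_surj_comp:
  assumes "cont_open_surj X Y f" "cont_open_surj Y Z g"
  shows "cont_open_surj X Z (\<lambda>x. g (f x))"
  using assms continuous_map_compose[of X Y f Z g] open_map_compose[of X Y f Z g]
    image_image[of g f "topspace X"]
  unfolding cont_open_surj_def by (simp add: o_def)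

lemma cont_open_surj_flip: "cont_open_surj unit_top unit_top (\<lambda>t. 1 - t)"
proof -
  have "homeomorphic_maps unit_top unit_top (\<lambda>t. 1 - t) (\<lambda>t::real. 1 - t)"
    by (auto simp: homeomorphic_maps_def intro!: continuous_intros)
  then have "homeomorphic_map unit_top unit_top (\<lambda>t::real. 1 - t)"
    by (rule homeomorphic_maps_map[THEN iffD1, THEN conjunct1])
  then show ?thesis
    unfolding cont_open_surj_def
    by (intro conjI homeomorphic_imp_continuous_map homeomorphic_imp_open_map homeomorphic_imp_surjective_map)
qed

lemma continuous_map_bond:
  assumes "\<And>n. continuous_map (X (Suc n)) (X n) (b n)"
  shows "continuous_map (X (n + k)) (X n) (bond b n k)"
proof (induction k)
  case 0
  then show ?case by (simp add: bond.simps(1)[abs_def])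
next
  case (Suc k)
  have "continuous_map (X (Suc (n + k))) (X (n + k)) (b (n + k))" using assms by blast
  from continuous_map_compose[OF this Suc.IH] show ?case
    by (simp add: bond.simps(2)[abs_def] o_def)
qed

lemma open_map_bond:
  assumes "\<And>n. open_map (X (Suc n)) (X n) (b n)"
  shows "open_map (X (n + k)) (X n) (bond b n k)"
proof (induction k)
  case 0
  then show ?case by (simp add: bond.simps(1)[abs_def] open_map_def)
next
  case (Suc k)
  have "open_map (X (Suc (n + k))) (X (n + k)) (b (n + k))" using assms by blast
  from open_map_compose[OF this Suc.IH] show ?case
    by (simp add: bond.simps(2)[abs_def] o_def)
qed

text \<open>A basic open set of the product restricts finitely many coordinates. On threads all these restrictions
  pull back to a single coordinate \<open>m\<close>, which may be taken as late as desired.\<close>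

lemma invlim_basic_neighbourhood:
  assumes cont: "\<And>n. continuous_map (X (Suc n)) (X n) (b n)"
    and U: "openin (invlim X b) U" and x: "x \<in> U"
  shows "\<exists>m V. N \<le> m \<and> openin (X m) V \<and> x m \<in> V \<and> (\<forall>y\<in>topspace (invlim X b). y m \<in> V \<longrightarrow> y \<in> U)"
proof -
  obtain W where W: "openin (product_topology X UNIV) W" "U = W \<inter> {x. \<forall>n. b n (x (Suc n)) = x n}"
    using U by (auto simp: invlim_def openin_subtopology)
  have xW: "x \<in> W" and xb: "\<And>n. b n (x (Suc n)) = x n" using x W by auto
  obtain B where B: "finite {i. B i \<noteq> topspace (X i)}" "\<And>i. openin (X i) (B i)" "\<And>i. x i \<in> B i"
    "Pi UNIV B \<subseteq> W"
  proof -
    have "\<exists>B. finite {i. B i \<noteq> topspace (X i)} \<and> (\<forall>i. openin (X i) (B i)) \<and> x \<in> Pi UNIV B \<and> Pi UNIV B \<subseteq> W"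
      using W(1) xW unfolding openin_product_topology_alt by (simp add: PiE_UNIV_domain)
    then show ?thesis using that by blast
  qed
  define J where "J = {i. B i \<noteq> topspace (X i)}"
  define m where "m = Max (insert N J)"
  have J: "finite J" using B(1) by (simp add: J_def)
  have Nm: "N \<le> m" and Jm: "\<And>i. i \<in> J \<Longrightarrow> i \<le> m" using J by (auto simp: m_def)
  define V where "V = topspace (X m) \<inter> (\<Inter>i\<in>J. {t \<in> topspace (X m). bond b i (m - i) t \<in> B i})"
  have "openin (X m) V"
  proof -
    have "openin (X m) {t \<in> topspace (X m). bond b i (m - i) t \<in> B i}" if "i \<in> J" for i
      using continuous_map_bond[where X = X and b = b and n = i and k = "m - i", OF cont] Jm[OF that] B(2)
      by (auto intro: openin_continuous_map_preimage)
    then show ?thesis unfolding V_def using J by (cases "J = {}") (auto intro!: openin_Int)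
  qed
  moreover have "x m \<in> V"
  proof -
    have "x m \<in> topspace (X m)" using B(2,3) openin_subset by blast
    moreover have "bond b i (m - i) (x m) = x i" if "i \<in> J" for i
      using bond_thread[of b x i "m - i", OF xb] Jm[OF that] by simp
    ultimately show ?thesis using B(3) by (auto simp: V_def)
  qed
  moreover have "y \<in> U" if y: "y \<in> topspace (invlim X b)" "y m \<in> V" for y
  proof -
    have yb: "\<And>n. b n (y (Suc n)) = y n" and yX: "\<And>n. y n \<in> topspace (X n)"
      using y(1) by (auto simp: topspace_invlim)
    have "y i \<in> B i" for i
    proof (cases "i \<in> J")
      case True
      then show ?thesis
        using bond_thread[of b y i "m - i", OF yb] Jm[OF True] y(2) by (auto simp: V_def)
    next
      case False
      then show ?thesis using yX by (simp add: J_def)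
    qed
    then show ?thesis using B(4) W(2) yb by (auto simp: PiE_UNIV_domain)
  qed
  ultimately show ?thesis using Nm by blast
qed

text \<open>A point of a basic open set, given at coordinate \<open>m \<ge> n\<close>, has as its \<open>n\<close>-th coordinates all values of the
  open bonding map from \<open>m\<close> to \<open>n\<close> on an open set, because a thread passes through every point of
  coordinate \<open>m\<close>.\<close>

lemma cont_open_surj_projection:
  assumes b: "\<And>n. cont_open_surj (X (Suc n)) (X n) (b n)"
  shows "cont_open_surj (invlim X b) (X n) (\<lambda>x. x n)"
proof -
  have cont: "\<And>n. continuous_map (X (Suc n)) (X n) (b n)"
    and opn: "\<And>n. open_map (X (Suc n)) (X n) (b n)"
    and surj: "\<And>n. b n ` topspace (X (Suc n)) = topspace (X n)"
    using b by (auto simp: cont_open_surj_def)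
  have through: "\<exists>x\<in>topspace (invlim X b). x m = t" if "t \<in> topspace (X m)" for m t
    using thread_through[of b "\<lambda>n. topspace (X n)", OF surj that] unfolding topspace_invlim by blast
  have "continuous_map (invlim X b) (X n) (\<lambda>x. x n)"
    unfolding invlim_def
    by (rule continuous_map_from_subtopology, rule continuous_map_product_projection) simp
  moreover have "open_map (invlim X b) (X n) (\<lambda>x. x n)"
    unfolding open_map_def
  proof (intro allI impI)
    fix U assume U: "openin (invlim X b) U"
    show "openin (X n) ((\<lambda>x. x n) ` U)"
    proof (rule openin_subopen[THEN iffD2], rule ballI)
      fix t assume "t \<in> (\<lambda>x. x n) ` U"
      then obtain x where x: "x \<in> U" and t: "t = x n" by auto
      obtain m V where V: "n \<le> m" "openin (X m) V" "x m \<in> V"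
        "\<forall>y\<in>topspace (invlim X b). y m \<in> V \<longrightarrow> y \<in> U"
        using invlim_basic_neighbourhood[where X = X and b = b and N = n, OF cont U x] by (elim exE conjE)
      have val: "bond b n (m - n) (y m) = y n" if "y \<in> topspace (invlim X b)" for y
        using bond_thread[of b y n "m - n"] that V(1) by (auto simp: topspace_invlim)
      have "openin (X n) (bond b n (m - n) ` V)"
        using open_map_bond[where X = X and b = b and n = n and k = "m - n", OF opn] V(1,2)
        by (simp add: open_map_def)
      moreover have "x n \<in> bond b n (m - n) ` V"
      proof (rule image_eqI)
        show "x n = bond b n (m - n) (x m)" using val[of x] x openin_subset[OF U] by auto
      qed (fact V(3))
      moreover have "bond b n (m - n) ` V \<subseteq> (\<lambda>x. x n) ` U"
      proof clarify
        fix t assume t: "t \<in> V"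
        then obtain y where "y \<in> topspace (invlim X b)" "y m = t"
          using through openin_subset[OF V(2)] by blast
        then show "bond b n (m - n) t \<in> (\<lambda>x. x n) ` U"
          using val[of y] V(4) t by (intro image_eqI[of _ _ y]) auto
      qed
      ultimately show "\<exists>T. openin (X n) T \<and> t \<in> T \<and> T \<subseteq> (\<lambda>x. x n) ` U" unfolding t by blast
    qed
  qed
  moreover have "(\<lambda>x. x n) ` topspace (invlim X b) = topspace (X n)"
  proof
    show "(\<lambda>x. x n) ` topspace (invlim X b) \<subseteq> topspace (X n)" by (auto simp: topspace_invlim)
    show "topspace (X n) \<subseteq> (\<lambda>x. x n) ` topspace (invlim X b)"
    proof
      fix t assume "t \<in> topspace (X n)"
      from through[OF this] show "t \<in> (\<lambda>x. x n) ` topspace (invlim X b)" by auto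
    qed
  qed
  ultimately show ?thesis by (simp add: cont_open_surj_def)
qed

section \<open>Open maps from the quotient to the interval\<close>

lemma compact_space_lim_top: "compact_space (lim_top K)"
proof -
  let ?P = "product_topology (\<lambda>n. discrete_topology {..<fst K n}) UNIV"
  have proj: "continuous_map ?P (discrete_topology {..<fst K n}) (\<lambda>x. x n)" for n
    by (rule continuous_map_product_projection) simp
  have coord: "continuous_map ?P (discrete_topology UNIV) (\<lambda>x. f (x n))" for f :: "nat \<Rightarrow> nat" and n
    using continuous_map_compose[OF proj[of n], of "discrete_topology UNIV" f] by (simp add: o_def)
  have "closedin ?P {x \<in> topspace ?P. snd K n (x (Suc n)) = x n}" for n
    using closedin_continuous_maps_eq[OF Hausdorff_space_discrete_topology
        coord[of "snd K n" "Suc n"] coord[of "\<lambda>v. v" n]] .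
  then have "closedin ?P (\<Inter>n. {x \<in> topspace ?P. snd K n (x (Suc n)) = x n})"
    by (intro closedin_Inter) auto
  moreover have "compact_space ?P"
    by (simp add: compact_space_product_topology compact_space_discrete_topology)
  ultimately have "compactin ?P (\<Inter>n. {x \<in> topspace ?P. snd K n (x (Suc n)) = x n})"
    by (simp add: closedin_compact_space)
  moreover have "topspace ?P \<inter> {x. \<forall>n. snd K n (x (Suc n)) = x n} =
      (\<Inter>n. {x \<in> topspace ?P. snd K n (x (Suc n)) = x n})" by auto
  ultimately have "compact_space (subtopology ?P (topspace ?P \<inter> {x. \<forall>n. snd K n (x (Suc n)) = x n}))"
    by (simp add: compact_space_subtopology)
  then show ?thesis
    unfolding lim_top_def invlim_def by (metis subtopology_restrict)
qed

lemma openin_cylinder: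
  "openin (lim_top K) {x \<in> lim_pts K. P (x m)}"
proof -
  have "continuous_map (lim_top K) (discrete_topology {..<fst K m}) (\<lambda>x. x m)"
    unfolding lim_top_def invlim_def
    by (rule continuous_map_from_subtopology, rule continuous_map_product_projection) simp
  from openin_continuous_map_preimage[OF this, of "{v. v < fst K m \<and> P v}"]
  have "openin (lim_top K) {x \<in> lim_pts K. x m < fst K m \<and> P (x m)}" by (simp add: subset_iff)
  moreover have "{x \<in> lim_pts K. x m < fst K m \<and> P (x m)} = {x \<in> lim_pts K. P (x m)}"
    by (auto simp: lim_pts_iff)
  ultimately show ?thesis by simp
qed

lemma closedin_cylinder: "closedin (lim_top K) {x \<in> lim_pts K. P (x m)}"
proof -
  have "lim_pts K - {x \<in> lim_pts K. P (x m)} = {x \<in> lim_pts K. \<not> P (x m)}" by blast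
  then show ?thesis using openin_cylinder[of K "\<lambda>v. \<not> P v" m] by (simp add: closedin_def)
qed

lemma cylinder_neighbourhood:
  assumes K: "is_lin_seq K" and U: "openin (lim_top K) U" and x: "x \<in> U"
  shows "\<exists>m. \<forall>y\<in>lim_pts K. y m = x m \<longrightarrow> y \<in> U"
proof -
  have "continuous_map (discrete_topology {..<fst K (Suc n)}) (discrete_topology {..<fst K n}) (snd K n)" for n
    using lin_seq_mor[OF K, of n] by (auto simp: lin_mor_def lin_epi_def)
  from invlim_basic_neighbourhood[where X = "\<lambda>n. discrete_topology {..<fst K n}" and b = "snd K",
      OF this, of U x 0] U x
  show ?thesis unfolding lim_top_def by metis
qed

text \<open>The cylinders on which \<open>\<phi>\<close> varies little cover the compact limit. Finitely many suffice, and the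
  largest level among them works everywhere.\<close>

lemma level_of_uniformity:
  assumes K: "is_lin_seq K" and \<phi>: "continuous_map (lim_top K) unit_top \<phi>" and \<eta>: "0 < \<eta>"
  shows "\<exists>m. \<forall>x\<in>lim_pts K. \<forall>y\<in>lim_pts K. x m = y m \<longrightarrow> \<bar>\<phi> x - \<phi> y\<bar> < \<eta>"
proof -
  have "\<exists>m. \<forall>y\<in>lim_pts K. y m = x m \<longrightarrow> \<bar>\<phi> y - \<phi> x\<bar> < \<eta> / 2" if x: "x \<in> lim_pts K" for x
  proof -
    have "openin unit_top ({0..1} \<inter> ball (\<phi> x) (\<eta> / 2))"
      by (metis open_ball openin_open_Int)
    then have "openin (lim_top K) {y \<in> lim_pts K. \<phi> y \<in> {0..1} \<inter> ball (\<phi> x) (\<eta> / 2)}"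
      by (rule openin_continuous_map_preimage[OF \<phi>])
    moreover have "\<phi> x \<in> {0..1}" using continuous_map_image_subset_topspace[OF \<phi>] x by auto
    ultimately obtain m where "\<forall>y\<in>lim_pts K. y m = x m \<longrightarrow>
        y \<in> {y \<in> lim_pts K. \<phi> y \<in> {0..1} \<inter> ball (\<phi> x) (\<eta> / 2)}"
      using cylinder_neighbourhood[OF K, of _ x] x \<eta> by force
    then show ?thesis by (intro exI[of _ m]) (auto simp: dist_real_def abs_minus_commute)
  qed
  then obtain lev where lev: "\<And>x y. x \<in> lim_pts K \<Longrightarrow> y \<in> lim_pts K \<Longrightarrow> y (lev x) = x (lev x) \<Longrightarrow>
      \<bar>\<phi> y - \<phi> x\<bar> < \<eta> / 2" by metis
  define cyl where "cyl x = {y \<in> lim_pts K. y (lev x) = x (lev x)}" for x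
  have "\<exists>\<F>. finite \<F> \<and> \<F> \<subseteq> cyl ` lim_pts K \<and> lim_pts K \<subseteq> \<Union>\<F>"
  proof (rule compactinD)
    show "compactin (lim_top K) (lim_pts K)" using compact_space_lim_top by (simp add: compact_space_def)
    show "openin (lim_top K) U" if U: "U \<in> cyl ` lim_pts K" for U
    proof -
      obtain x where "U = {y \<in> lim_pts K. y (lev x) = x (lev x)}" using U by (auto simp: cyl_def)
      then show ?thesis using openin_cylinder[of K "\<lambda>v. v = x (lev x)" "lev x"] by simp
    qed
    show "lim_pts K \<subseteq> \<Union> (cyl ` lim_pts K)" by (auto simp: cyl_def)
  qed
  then obtain S where S: "finite S" "S \<subseteq> lim_pts K" "lim_pts K \<subseteq> \<Union> (cyl ` S)"
    by (metis finite_subset_image)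
  define m where "m = Max (insert 0 (lev ` S))"
  have "\<bar>\<phi> x - \<phi> y\<bar> < \<eta>" if xy: "x \<in> lim_pts K" "y \<in> lim_pts K" "x m = y m" for x y
  proof -
    obtain s where s: "s \<in> S" "x (lev s) = s (lev s)" using S(3) xy(1) by (auto simp: cyl_def)
    have "lev s \<le> m" using S(1) s(1) by (simp add: m_def)
    then have "x (lev s) = y (lev s)"
      using threads_determined_below[of "snd K" x y m "lev s"] xy by (simp add: lim_pts_iff)
    then have "\<bar>\<phi> x - \<phi> s\<bar> < \<eta> / 2" "\<bar>\<phi> y - \<phi> s\<bar> < \<eta> / 2"
      using lev[of s x] lev[of s y] s S(2) xy by auto
    then show ?thesis by linarith
  qed
  then show ?thesis by blast
qed

lemma least_value_of_open_set_in_unit_interval: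
  assumes S: "openin unit_top S" and t: "t \<in> S" "\<And>s. s \<in> S \<Longrightarrow> t \<le> s"
  shows "t = 0"
proof (rule ccontr)
  assume "t \<noteq> 0"
  have t01: "0 \<le> t" "t \<le> 1" using openin_subset[OF S] t by auto
  obtain e where e: "0 < e" "\<And>s. s \<in> {0..1} \<Longrightarrow> dist s t < e \<Longrightarrow> s \<in> S"
    using S t(1) unfolding openin_euclidean_subtopology_iff by blast
  have "max 0 (t - e / 2) \<in> S"
    using e t01 \<open>t \<noteq> 0\<close> by (intro e(2)) (auto simp: dist_real_def max_def)
  then show False using t(2) e(1) t01 \<open>t \<noteq> 0\<close> by fastforce
qed

lemma topspace_quot_top: "topspace (quot_top K) = quot_map K ` lim_pts K"
  by (simp add: quot_top_def topspace_final_topology)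

context
  fixes K :: lin_seq and F :: "(nat \<Rightarrow> nat) set \<Rightarrow> real"
  assumes K: "fraisse_limit K" and F: "cont_open_surj (quot_top K) unit_top F"
begin

lemma continuous_map_lifted: "continuous_map (lim_top K) unit_top (\<lambda>x. F (quot_map K x))"
proof -
  have "continuous_map (lim_top K) (quot_top K) (quot_map K)"
    by (simp add: quot_top_def quotient_imp_continuous_map quotient_map_final_topology)
  then show ?thesis
    using F continuous_map_compose[of _ _ "quot_map K" _ F] by (auto simp: cont_open_surj_def o_def)
qed

lemma lifted_range: "x \<in> lim_pts K \<Longrightarrow> 0 \<le> F (quot_map K x) \<and> F (quot_map K x) \<le> 1"
  using continuous_map_image_subset_topspace[OF continuous_map_lifted] by fastforce

lemma lifted_surj:
  assumes "0 \<le> t" "t \<le> 1"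
  shows "\<exists>x\<in>lim_pts K. F (quot_map K x) = t"
proof -
  have "t \<in> F ` topspace (quot_top K)" using F assms by (simp add: cont_open_surj_def)
  then show ?thesis unfolding topspace_quot_top by auto
qed

text \<open>Openness of \<open>F\<close> on the quotient gives open images only for open sets that are unions of classes.\<close>

lemma openin_lifted_image:
  assumes V: "openin (lim_top K) V" and sat: "\<And>x y. x \<in> V \<Longrightarrow> (y, x) \<in> lim_rel K \<Longrightarrow> y \<in> V"
  shows "openin unit_top ((\<lambda>x. F (quot_map K x)) ` V)"
proof -
  have "{y \<in> lim_pts K. quot_map K y \<in> quot_map K ` V} = V"
    using openin_subset[OF V] sat lim_rel_of_quot_map_eq[of _ K] by (auto 0 3)
  then have "openin (quot_top K) (quot_map K ` V)"
    using V openin_subset[OF V] by (auto simp: quot_top_def openin_final_topology)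
  then have "openin unit_top (F ` quot_map K ` V)"
    using F by (simp add: cont_open_surj_def open_map_def)
  then show ?thesis by (simp add: image_image)
qed

lemma lifted_attains_minimum:
  assumes W: "closedin (lim_top K) W" and ne: "W \<noteq> {}"
  shows "\<exists>x\<in>W. \<forall>y\<in>W. F (quot_map K x) \<le> F (quot_map K y)"
proof -
  have "compactin (lim_top K) W" using W compact_space_lim_top closedin_compact_space by blast
  then have "compactin unit_top ((\<lambda>x. F (quot_map K x)) ` W)"
    using image_compactin continuous_map_lifted by blast
  then have "compact ((\<lambda>x. F (quot_map K x)) ` W)" by (simp add: compactin_subtopology)
  from compact_attains_inf[OF this] ne show ?thesis by blast
qed

end

text \<open>The approximate form of the valley condition of \<open>fold_map\<close>: a valley counts if it is deeper than \<open>4 * e\<close>,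
  and it must come within \<open>e\<close> of \<open>0\<close>. At the two ends of the domain one wall is enough, which includes
  the condition that an end is not sent to an intermediate value. Peaks are the valleys of the
  function reflected at its maximum.\<close>

definition valleys_sink :: "real \<Rightarrow> nat \<Rightarrow> (nat \<Rightarrow> real) \<Rightarrow> bool" where
  "valleys_sink e n G \<longleftrightarrow> (\<forall>a b c. a \<le> b \<and> b \<le> c \<and> c < n \<and>
     (a = 0 \<or> G b + 4 * e \<le> G a) \<and> (c = n - 1 \<or> G b + 4 * e \<le> G c) \<longrightarrow> (\<exists>d\<in>{a..c}. G d \<le> e))"

lemma valleys_sinkD:
  assumes "valleys_sink e n G" "a \<le> b" "b \<le> c" "c < n"
    "a = 0 \<or> G b + 4 * e \<le> G a" "c = n - 1 \<or> G b + 4 * e \<le> G c"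
  shows "\<exists>d\<in>{a..c}. G d \<le> e"
  using assms unfolding valleys_sink_def by blast

text \<open>Here openness is used. Let \<open>W\<close> be the set of points that lie over the interval \<open>{a..c}\<close> of level \<open>m\<close>. The
  minimum of \<open>F\<close> over \<open>W\<close> is attained on the set \<open>V\<close> of points of \<open>W\<close> with \<open>F < \<theta>\<close>. If the walls of the
  valley rise above \<open>\<theta>\<close>, then \<open>V\<close> contains no point over a wall, hence is a union of classes and has
  an open image. An open subset of \<open>[0,1]\<close> with a least element contains \<open>0\<close>.\<close>

lemma sampled_valleys_sink:
  assumes K: "fraisse_limit K" and F: "cont_open_surj (quot_top K) unit_top F" and \<eta>: "0 < \<eta>"
    and osc: "\<And>x y. x \<in> lim_pts K \<Longrightarrow> y \<in> lim_pts K \<Longrightarrow> x m = y m \<Longrightarrow>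
      \<bar>F (quot_map K x) - F (quot_map K y)\<bar> < \<eta>"
    and r: "\<And>v. v < fst K m \<Longrightarrow> r v \<in> lim_pts K \<and> r v m = v"
  shows "valleys_sink \<eta> (fst K m) (\<lambda>v. F (quot_map K (r v)))"
  unfolding valleys_sink_def
proof (intro allI impI, elim conjE)
  define G where "G v = F (quot_map K (r v))" for v
  fix a b c assume abc: "a \<le> b" "b \<le> c" "c < fst K m"
    and ra: "a = 0 \<or> F (quot_map K (r b)) + 4 * \<eta> \<le> F (quot_map K (r a))"
    and rc: "c = fst K m - 1 \<or> F (quot_map K (r b)) + 4 * \<eta> \<le> F (quot_map K (r c))"
  define W where "W = {x \<in> lim_pts K. a \<le> x m \<and> x m \<le> c}"
  \<comment> \<open>The threshold lies below all values over the walls, which are at least \<open>4 * \<eta> - \<eta>\<close> above the valley.\<close>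
  define \<theta> where "\<theta> = F (quot_map K (r b)) + 3 * \<eta>"
  define V where "V = {x \<in> lim_pts K. F (quot_map K x) \<in> {0..1} \<inter> {..<\<theta>}} \<inter> W"
  have V_iff: "x \<in> V \<longleftrightarrow> x \<in> W \<and> F (quot_map K x) < \<theta>" for x
    using lifted_range[OF K F] by (auto simp: V_def W_def)
  have rb: "r b \<in> V" using r[of b] abc \<eta> by (auto simp: V_iff W_def \<theta>_def)
  have "openin unit_top ({0..1} \<inter> {..<\<theta>})" by (metis open_lessThan openin_open_Int)
  from openin_continuous_map_preimage[OF continuous_map_lifted[OF K F] this]
  have "openin (lim_top K) V"
    unfolding V_def W_def by (rule openin_Int) (rule openin_cylinder)
  moreover have "y \<in> V" if x: "x \<in> V" and yx: "(y, x) \<in> lim_rel K" for x y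
  proof -
    have xW: "x \<in> lim_pts K" "a \<le> x m" "x m \<le> c" and x\<theta>: "F (quot_map K x) < \<theta>"
      using x by (auto simp: V_iff W_def)
    have y: "y \<in> lim_pts K" and near: "\<bar>int (y m) - int (x m)\<bar> \<le> 1" and ym: "y m < fst K m"
      using yx by (auto simp: lim_rel_def lin_edges_def)
    have "a = 0 \<or> x m \<noteq> a"
      using osc[of x "r a"] r[of a] ra abc xW(1) x\<theta> by (force simp: \<theta>_def)
    moreover have "c = fst K m - 1 \<or> x m \<noteq> c"
      using osc[of x "r c"] r[of c] rc abc xW(1) x\<theta> by (force simp: \<theta>_def)
    ultimately have "y \<in> W" using xW y near ym by (auto simp: W_def)
    then show ?thesis using x\<theta> quot_map_eq[OF K yx] by (simp add: V_iff)
  qed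
  ultimately have opn: "openin unit_top ((\<lambda>x. F (quot_map K x)) ` V)"
    by (rule openin_lifted_image[OF K F])
  have "closedin (lim_top K) W" unfolding W_def by (rule closedin_cylinder)
  then obtain x where x: "x \<in> W" "\<And>y. y \<in> W \<Longrightarrow> F (quot_map K x) \<le> F (quot_map K y)"
    using lifted_attains_minimum[OF K F, of W] rb V_iff by blast
  have "x \<in> V" using x(1) x(2)[of "r b"] rb \<eta> by (auto simp: V_iff \<theta>_def)
  then have "F (quot_map K x) = 0"
    using x(2) V_iff by (intro least_value_of_open_set_in_unit_interval[OF opn]) auto
  moreover have "x m < fst K m" "x \<in> lim_pts K" using x(1) by (auto simp: W_def lim_pts_iff)
  ultimately have "F (quot_map K (r (x m))) < \<eta>"
    using osc[of x "r (x m)"] r[of "x m"] by auto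
  then show "\<exists>d\<in>{a..c}. F (quot_map K (r d)) \<le> \<eta>"
    using x(1) by (intro bexI[of _ "x m"]) (auto simp: W_def)
qed

text \<open>\<open>G\<close> evaluates \<open>F\<close> at one point over each vertex of a sufficiently late level. Adjacent vertices are
  coordinates of equivalent points, on which \<open>F\<close> agrees, and so \<open>G\<close> moves slowly.\<close>

lemma finite_level_sample:
  assumes K: "fraisse_limit K" and F: "cont_open_surj (quot_top K) unit_top F" and \<eta>: "0 < \<eta>"
  shows "\<exists>m G. (\<forall>x\<in>lim_pts K. \<bar>F (quot_map K x) - G (x m)\<bar> < \<eta>) \<and> (\<forall>v<fst K m. 0 \<le> G v \<and> G v \<le> 1) \<and>
    (\<forall>v. Suc v < fst K m \<longrightarrow> \<bar>G (Suc v) - G v\<bar> < 2 * \<eta>) \<and>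
    valleys_sink \<eta> (fst K m) G \<and> valleys_sink \<eta> (fst K m) (\<lambda>v. 1 - G v)"
proof -
  note S = fraisse_limit_lin_seq[OF K]
  obtain m where osc: "\<And>x y. x \<in> lim_pts K \<Longrightarrow> y \<in> lim_pts K \<Longrightarrow> x m = y m \<Longrightarrow>
      \<bar>F (quot_map K x) - F (quot_map K y)\<bar> < \<eta>"
    using level_of_uniformity[OF S continuous_map_lifted[OF K F] \<eta>] by blast
  obtain r where r: "\<And>v. v < fst K m \<Longrightarrow> r v \<in> lim_pts K \<and> r v m = v"
    using lim_pts_through[OF S, of _ m] by metis
  define G where "G v = F (quot_map K (r v))" for v
  have near: "\<bar>F (quot_map K x) - G (x m)\<bar> < \<eta>" if "x \<in> lim_pts K" for x
    using osc[of x "r (x m)"] r[of "x m"] that by (simp add: G_def lim_pts_iff)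
  have "\<bar>G (Suc v) - G v\<bar> < 2 * \<eta>" if v: "Suc v < fst K m" for v
  proof -
    have "(v, Suc v) \<in> lin_edges (fst K m)" using v by (simp add: lin_edges_def)
    then obtain x y where xy: "(x, y) \<in> lim_rel K" "x m = v" "y m = Suc v"
      using lim_rel_through[OF S] by blast
    then have "x \<in> lim_pts K" "y \<in> lim_pts K" by (auto simp: lim_rel_def)
    from near[OF this(1)] near[OF this(2)] show ?thesis using xy quot_map_eq[OF K xy(1)] by simp
  qed
  moreover have "0 \<le> G v \<and> G v \<le> 1" if "v < fst K m" for v
    using lifted_range[OF K F] r[OF that] by (simp add: G_def)
  moreover have "valleys_sink \<eta> (fst K m) G"
    unfolding G_def by (rule sampled_valleys_sink[OF K F \<eta> osc r])
  moreover have "valleys_sink \<eta> (fst K m) (\<lambda>v. 1 - G v)"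
    unfolding G_def
    by (rule sampled_valleys_sink[OF K cont_open_surj_comp[OF F cont_open_surj_flip] \<eta> _ r])
      (use osc in \<open>auto simp: abs_minus_commute\<close>)
  ultimately show ?thesis using near by blast
qed

text \<open>Suppose the value at the endpoint is intermediate, and let \<open>p\<close> be the first vertex at which the sampled
  function is nearly \<open>0\<close> or nearly \<open>1\<close>. In the first case the left end is a peak on \<open>{0..p}\<close>, which has to
  reach nearly \<open>1\<close>; in the second case it is a valley, which has to sink to nearly \<open>0\<close>. Either happens
  before \<open>p\<close>, contrary to the choice of \<open>p\<close>.\<close>

lemma endpoint_to_endpoint:
  assumes K: "fraisse_limit K" and F: "cont_open_surj (quot_top K) unit_top F"
  shows "F (quot_map K lim_zero) \<in> {0, 1}"
proof (rule ccontr)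
  note S = fraisse_limit_lin_seq[OF K]
  define t where "t = F (quot_map K lim_zero)"
  assume "F (quot_map K lim_zero) \<notin> {0, 1}"
  then have t: "0 < t" "t < 1"
    using lifted_range[OF K F lim_zero_in[OF S]] by (auto simp: t_def)
  \<comment> \<open>In spite of sampling errors, the value at the endpoint stays \<open>4 * \<eta>\<close> away from all values within \<open>\<eta>\<close> of \<open>0\<close> or \<open>1\<close>.\<close>
  define \<eta> where "\<eta> = min t (1 - t) / 8"
  have \<eta>: "0 < \<eta>" "8 * \<eta> \<le> t" "8 * \<eta> \<le> 1 - t" using t by (auto simp: \<eta>_def)
  obtain m G where near: "\<And>x. x \<in> lim_pts K \<Longrightarrow> \<bar>F (quot_map K x) - G (x m)\<bar> < \<eta>"
    and sink: "valleys_sink \<eta> (fst K m) G" "valleys_sink \<eta> (fst K m) (\<lambda>v. 1 - G v)"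
    using finite_level_sample[OF K F \<eta>(1)] by blast
  have G0: "\<bar>t - G 0\<bar> < \<eta>" using near[OF lim_zero_in[OF S]] by (simp add: t_def lim_zero_def)
  define p where "p = (LEAST v. v < fst K m \<and> (G v \<le> \<eta> \<or> 1 - G v \<le> \<eta>))"
  obtain x where x: "x \<in> lim_pts K" "F (quot_map K x) = 0" using lifted_surj[OF K F, of 0] by auto
  have "x m < fst K m \<and> (G (x m) \<le> \<eta> \<or> 1 - G (x m) \<le> \<eta>)" using near[OF x(1)] x by (auto simp: lim_pts_iff)
  then have p: "p < fst K m" "G p \<le> \<eta> \<or> 1 - G p \<le> \<eta>"
    unfolding p_def by (metis (mono_tags, lifting) LeastI)+
  have least: "\<not> (G v \<le> \<eta> \<or> 1 - G v \<le> \<eta>)" if "v < p" for v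
    using not_less_Least[of v "\<lambda>v. v < fst K m \<and> (G v \<le> \<eta> \<or> 1 - G v \<le> \<eta>)"] that p(1)
    by (auto simp: p_def)
  from p(2) show False
  proof
    assume Gp: "G p \<le> \<eta>"
    then have "4 * \<eta> - G 0 \<le> - G p" using G0 \<eta> by linarith
    then obtain d where d: "d \<in> {0..p}" "1 - G d \<le> \<eta>"
      using valleys_sinkD[OF sink(2), of 0 0 p] p(1) by auto
    then have "d = p" using least[of d] by (cases "d = p") auto
    then show False using d Gp \<eta> t by simp
  next
    assume Gp: "1 - G p \<le> \<eta>"
    then have "G 0 + 4 * \<eta> \<le> G p" using G0 \<eta> by linarith
    then obtain d where d: "d \<in> {0..p}" "G d \<le> \<eta>"
      using valleys_sinkD[OF sink(1), of 0 0 p] p(1) by auto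
    then have "d = p" using least[of d] by (cases "d = p") auto
    then show False using d Gp \<eta> t by simp
  qed
qed

section \<open>Quantisation with hysteresis\<close>

lemma first_exit:
  fixes Q :: "nat \<Rightarrow> bool"
  assumes "a \<le> b" "Q a" "\<not> Q b"
  shows "\<exists>s\<ge>a. s < b \<and> (\<forall>u\<in>{a..s}. Q u) \<and> \<not> Q (Suc s)"
proof -
  define w where "w = (LEAST w. a \<le> w \<and> \<not> Q w)"
  have w: "a \<le> w \<and> \<not> Q w" unfolding w_def by (rule LeastI[of _ b]) (use assms in simp)
  have "w \<le> b" unfolding w_def by (rule Least_le) (use assms in simp)
  have min: "Q v" if "a \<le> v" "v < w" for v
    using not_less_Least[of v "\<lambda>w. a \<le> w \<and> \<not> Q w"] that by (auto simp: w_def)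
  have "w \<noteq> a" using w assms(2) by auto
  then obtain s where "w = Suc s" "a \<le> s" using w by (cases w) auto
  then show ?thesis using min w \<open>w \<le> b\<close> by (intro exI[of _ s]) auto
qed

lemma last_exit:
  fixes Q :: "nat \<Rightarrow> bool"
  assumes "a \<le> b" "Q a" "\<not> Q b"
  shows "\<exists>s\<ge>a. s < b \<and> Q s \<and> (\<forall>u\<in>{Suc s..b}. \<not> Q u)"
  using assms
proof (induction b rule: dec_induct)
  case (step b)
  show ?case
  proof (cases "Q b")
    case True
    then show ?thesis using step by (intro exI[of _ b]) auto
  next
    case False
    then obtain s where "a \<le> s" "s < b" "Q s" "\<forall>u\<in>{Suc s..b}. \<not> Q u" using step by blast
    then show ?thesis using step by (intro exI[of _ s]) (auto simp: le_Suc_eq)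
  qed
qed simp

text \<open>Rounding \<open>G\<close> to integers with hysteresis: \<open>l\<close> is left upwards at \<open>l + 3/4\<close>, and \<open>l + 1\<close> is left downwards
  at \<open>l + 1/4\<close>. An ascent followed by a descent between the same two integers therefore means that \<open>G\<close>
  has moved by at least \<open>1/2\<close> in between.\<close>

primrec quantise :: "(nat \<Rightarrow> real) \<Rightarrow> nat \<Rightarrow> nat" where
  "quantise G 0 = 0"
| "quantise G (Suc v) =
    (if real (quantise G v) + 3/4 \<le> G (Suc v) then Suc (quantise G v)
     else if G (Suc v) \<le> real (quantise G v) - 3/4 then quantise G v - 1
     else quantise G v)"

text \<open>Steps below \<open>1/4\<close> ensure that one unit step of the rounded value always catches up with \<open>G\<close>.\<close>

locale slow_function =
  fixes G :: "nat \<Rightarrow> real" and n :: nat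
  assumes nonneg: "v < n \<Longrightarrow> 0 \<le> G v" and start: "G 0 \<le> 1/4"
    and slow: "Suc v < n \<Longrightarrow> \<bar>G (Suc v) - G v\<bar> < 1/4"
begin

abbreviation "\<phi> \<equiv> quantise G"

lemma quantise_near: "v < n \<Longrightarrow> \<bar>G v - \<phi> v\<bar> < 3/4"
proof (induction v)
  case 0
  then show ?case using nonneg[of 0] start by simp
next
  case (Suc v)
  have ih: "\<bar>G v - \<phi> v\<bar> < 3/4" using Suc by simp
  have sl: "\<bar>G (Suc v) - G v\<bar> < 1/4" using slow Suc.prems by simp
  show ?case
  proof (cases "G (Suc v) \<le> real (\<phi> v) - 3/4")
    case True
    then have "0 < \<phi> v" using nonneg[OF Suc.prems] by (cases "\<phi> v") auto
    then have "real (\<phi> v - 1) = real (\<phi> v) - 1" by (simp add: of_nat_diff)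
    moreover have "\<phi> (Suc v) = \<phi> v - 1" using True by simp
    ultimately show ?thesis using True ih sl by linarith
  next
    case False
    show ?thesis
    proof (cases "real (\<phi> v) + 3/4 \<le> G (Suc v)")
      case True
      then have "real (\<phi> (Suc v)) = real (\<phi> v) + 1" by simp
      then show ?thesis using True ih sl by linarith
    next
      case not_above: False
      then have "real (\<phi> (Suc v)) = real (\<phi> v)" using False by simp
      then show ?thesis using False not_above by linarith
    qed
  qed
qed

lemma quantise_step: "\<phi> (Suc v) \<le> Suc (\<phi> v)" "\<phi> v \<le> Suc (\<phi> (Suc v))"
  by auto

lemma quantise_ascends:
  assumes "\<phi> v \<le> l" "l < \<phi> (Suc v)"
  shows "real l + 3/4 \<le> G (Suc v)"
  using assms by (auto split: if_splits)

lemma quantise_descends: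
  assumes "l < \<phi> v" "\<phi> (Suc v) \<le> l"
  shows "G (Suc v) \<le> real l + 1/4"
proof -
  have "\<phi> v = Suc l" "\<phi> (Suc v) \<noteq> \<phi> v" using assms quantise_step(2)[of v] by auto
  then show ?thesis using assms by (auto split: if_splits)
qed

declare quantise.simps(2) [simp del]

lemma last_ascent:
  assumes "l < \<phi> s"
  shows "\<exists>r. r \<le> s \<and> real l + 3/4 \<le> G r \<and> (\<forall>u\<in>{r..s}. l < \<phi> u)"
proof -
  obtain q where "q < s" "\<phi> q \<le> l" "\<forall>u\<in>{Suc q..s}. l < \<phi> u"
    using last_exit[of 0 s "\<lambda>u. \<phi> u \<le> l", unfolded not_le] assms by auto
  then show ?thesis using quantise_ascends[of q l] by (intro exI[of _ "Suc q"]) auto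
qed

text \<open>The alternative \<open>r = 0\<close> corresponds to the condition at the left end in \<open>valleys_sink\<close>: if the rounded value
  has been at most \<open>l\<close> from the start, no descent is available to provide the wall.\<close>

lemma last_descent:
  assumes "\<phi> s \<le> l"
  shows "\<exists>r. r \<le> s \<and> (r = 0 \<or> G r \<le> real l + 1/4) \<and> (\<forall>u\<in>{r..s}. \<phi> u \<le> l)"
proof (cases "\<forall>u\<in>{0..s}. \<phi> u \<le> l")
  case True
  then show ?thesis by blast
next
  case False
  then obtain p where "p \<le> s" "l < \<phi> p" by force
  then obtain q where "q < s" "l < \<phi> q" "\<forall>u\<in>{Suc q..s}. \<phi> u \<le> l"
    using last_exit[of p s "\<lambda>u. l < \<phi> u", unfolded not_less] assms by auto
  then show ?thesis using quantise_descends[of l q] by (intro exI[of _ "Suc q"]) auto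
qed

lemma first_ascent:
  assumes "a \<le> b" "\<phi> a \<le> l" "l < \<phi> b"
  shows "\<exists>s\<ge>a. s < b \<and> (\<forall>u\<in>{a..s}. \<phi> u \<le> l) \<and> real l + 3/4 \<le> G (Suc s)"
proof -
  obtain s where "a \<le> s" "s < b" "\<forall>u\<in>{a..s}. \<phi> u \<le> l" "l < \<phi> (Suc s)"
    using first_exit[of a b "\<lambda>u. \<phi> u \<le> l", unfolded not_le] assms by auto
  then show ?thesis using quantise_ascends[of s l] by (intro exI[of _ s]) auto
qed

lemma first_descent:
  assumes "a \<le> b" "l < \<phi> a" "\<phi> b \<le> l"
  shows "\<exists>s\<ge>a. s < b \<and> (\<forall>u\<in>{a..s}. l < \<phi> u) \<and> G (Suc s) \<le> real l + 1/4"
proof -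
  obtain s where "a \<le> s" "s < b" "\<forall>u\<in>{a..s}. l < \<phi> u" "\<phi> (Suc s) \<le> l"
    using first_exit[of a b "\<lambda>u. l < \<phi> u", unfolded not_less] assms by auto
  then show ?thesis using quantise_descends[of l s] by (intro exI[of _ s]) auto
qed

lemma quantise_bottom: "d < n \<Longrightarrow> G d \<le> 1/8 \<Longrightarrow> \<phi> d = 0"
  using quantise_near[of d] by linarith

text \<open>A valley of the rounded function \<open>\<phi>\<close> need not lie over a valley of \<open>G\<close> on the same interval, as
  \<open>\<phi>\<close> may have descended to its value at \<open>a\<close> with \<open>G\<close> already close to the threshold. Moving the left wall
  back to the last ascent of \<open>\<phi>\<close> gives a valley of \<open>G\<close> of depth \<open>1/2 = 4 * 1/8\<close>. The point \<open>d\<close> where \<open>G\<close> sinks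
  to the bottom is still in the original interval, because \<open>\<phi> d = 0\<close>, whereas \<open>\<phi>\<close> is positive on
  the added part.\<close>

lemma fold_map_quantise:
  assumes n: "2 \<le> n" and k: "2 \<le> k" and top: "\<And>v. v < n \<Longrightarrow> G v \<le> real k - 1"
    and hit: "t < n" "real k - 1 - 1/8 \<le> G t"
    and sink: "valleys_sink (1/8) n G" and peak: "valleys_sink (1/8) n (\<lambda>v. real k - 1 - G v)"
  shows "fold_map n k \<phi>"
proof -
  have below: "\<phi> v < k" if "v < n" for v
    using quantise_near[OF that] top[OF that] by linarith
  have at_top: "\<phi> d = k - 1" if "d < n" "real k - 1 - 1/8 \<le> G d" for d
    using quantise_near[OF that(1)] below[OF that(1)] that(2) k by linarith
  have valleys: "\<exists>d\<in>{a..c}. \<phi> d = 0"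
    if abc: "a \<le> b" "b \<le> c" "c < n" "\<phi> b < \<phi> a" "\<phi> b < \<phi> c" for a b c
  proof -
    obtain s where s: "a \<le> s" "s < b" "\<forall>u\<in>{a..s}. \<phi> b < \<phi> u" "G (Suc s) \<le> real (\<phi> b) + 1/4"
      using first_descent[of a b "\<phi> b"] abc by auto
    obtain r where r: "r \<le> s" "real (\<phi> b) + 3/4 \<le> G r" "\<forall>u\<in>{r..s}. \<phi> b < \<phi> u"
      using last_ascent[of "\<phi> b" s] s by auto
    obtain t where t: "b \<le> t" "t < c" "real (\<phi> b) + 3/4 \<le> G (Suc t)"
      using first_ascent[of b c "\<phi> b"] abc by auto
    obtain d where d: "d \<in> {r..Suc t}" "G d \<le> 1/8"
      using valleys_sinkD[OF sink, of r "Suc s" "Suc t"] r s t abc by auto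
    have "\<phi> d = 0" using quantise_bottom[of d] d t abc by auto
    moreover have "s < d"
    proof (rule ccontr)
      assume "\<not> s < d"
      then have "\<phi> b < \<phi> d" using r(3) d(1) by auto
      then show False using \<open>\<phi> d = 0\<close> by simp
    qed
    ultimately show ?thesis using d(1) s t by (intro bexI[of _ d]) auto
  qed
  have peaks: "\<exists>d\<in>{a..c}. \<phi> d = k - 1"
    if abc: "a \<le> b" "b \<le> c" "c < n" "\<phi> a < \<phi> b" "\<phi> c < \<phi> b" for a b c
  proof -
    \<comment> \<open>Crossings between \<open>l\<close> and \<open>l + 1 = \<phi> b\<close> play the role of those between \<open>\<phi> b\<close> and \<open>\<phi> b + 1\<close> for a valley.\<close>
    define l where "l = \<phi> b - 1"
    have l: "\<phi> b = Suc l" "\<phi> a \<le> l" "\<phi> c \<le> l" using abc by (auto simp: l_def)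
    obtain s where s: "a \<le> s" "s < b" "\<forall>u\<in>{a..s}. \<phi> u \<le> l" "real l + 3/4 \<le> G (Suc s)"
      using first_ascent[of a b l] abc l by auto
    obtain r where r: "r \<le> s" "r = 0 \<or> G r \<le> real l + 1/4" "\<forall>u\<in>{r..s}. \<phi> u \<le> l"
      using last_descent[of s l] s by auto
    obtain t where t: "b \<le> t" "t < c" "G (Suc t) \<le> real l + 1/4"
      using first_descent[of b c l] abc l by auto
    obtain d where d: "d \<in> {r..Suc t}" "real k - 1 - 1/8 \<le> G d"
      using valleys_sinkD[OF peak, of r "Suc s" "Suc t"] r s t abc by fastforce
    have top_d: "\<phi> d = k - 1" using at_top[of d] d t abc by auto
    have "l < k - 1" using below[of b] abc l by auto
    have "s < d"
    proof (rule ccontr)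
      assume "\<not> s < d"
      then have "\<phi> d \<le> l" using r(3) d(1) by auto
      then show False using top_d \<open>l < k - 1\<close> by simp
    qed
    then show ?thesis using top_d d(1) s t by (intro bexI[of _ d]) auto
  qed
  have last: "\<phi> (n - 1) = 0 \<or> \<phi> (n - 1) = k - 1"
  proof (rule ccontr)
    assume not_end: "\<not> (\<phi> (n - 1) = 0 \<or> \<phi> (n - 1) = k - 1)"
    define l where "l = \<phi> (n - 1)"
    have l: "0 < l" "l < k - 1" using not_end below[of "n - 1"] n by (auto simp: l_def)
    \<comment> \<open>Consider the last change of \<open>\<phi>\<close>; whichever its direction, \<open>G\<close> has a one-sided valley or peak at the right end.\<close>
    have "\<exists>s\<ge>0. s < n - 1 \<and> \<phi> s \<noteq> l \<and> (\<forall>u\<in>{Suc s..n - 1}. \<not> \<phi> u \<noteq> l)"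
      by (rule last_exit) (use l(1) in \<open>simp_all add: l_def\<close>)
    then obtain s where s: "s < n - 1" "\<phi> s \<noteq> l" "\<forall>u\<in>{Suc s..n - 1}. \<phi> u = l" by blast
    have Ss: "\<phi> (Suc s) = l" using s by simp
    show False
    proof (cases "l < \<phi> s")
      case True
      have Gs: "G (Suc s) \<le> real l + 1/4" using quantise_descends[OF True] Ss by simp
      obtain r where r: "r \<le> s" "real l + 3/4 \<le> G r" "\<forall>u\<in>{r..s}. l < \<phi> u"
        using last_ascent[OF True] by blast
      obtain d where d: "d \<in> {r..n - 1}" "G d \<le> 1/8"
        using valleys_sinkD[OF sink, of r "Suc s" "n - 1"] r s Gs n by auto
      have "\<phi> d = 0" using quantise_bottom[of d] d n by auto
      moreover have "0 < \<phi> d" using bspec[OF r(3), of d] bspec[OF s(3), of d] d(1) l by (cases "d \<le> s") auto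
      ultimately show False by simp
    next
      case False
      have below_l: "\<phi> s \<le> l - 1" using False s(2) l by simp
      have Gs: "real (l - 1) + 3/4 \<le> G (Suc s)" using quantise_ascends[OF below_l] Ss l by simp
      obtain r where r: "r \<le> s" "r = 0 \<or> G r \<le> real (l - 1) + 1/4" "\<forall>u\<in>{r..s}. \<phi> u \<le> l - 1"
        using last_descent[OF below_l] by blast
      obtain d where d: "d \<in> {r..n - 1}" "real k - 1 - 1/8 \<le> G d"
        using valleys_sinkD[OF peak, of r "Suc s" "n - 1"] r s Gs n by fastforce
      have "\<phi> d = k - 1" using at_top[of d] d n by auto
      moreover have "\<phi> d \<le> l" using bspec[OF r(3), of d] bspec[OF s(3), of d] d(1) l by (cases "d \<le> s") auto
      ultimately show False using l by simp
    qed
  qed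
  have "\<exists>v<n. \<phi> v = k - 1" using at_top hit by blast
  moreover have "\<phi> (n - 1) \<in> {0, k - 1}" using last by blast
  ultimately show ?thesis
    unfolding fold_map_def using n k below valleys peaks quantise_step by auto
qed

end

section \<open>Approximating open maps by level maps\<close>

lemma valleys_sink_scale:
  assumes "valleys_sink e n G" "0 < r"
  shows "valleys_sink (r * e) n (\<lambda>v. r * G v)"
proof -
  have eq: "r * y + 4 * (r * e) \<le> r * x \<longleftrightarrow> y + 4 * e \<le> x" for x y
    using mult_le_cancel_left_pos[OF assms(2), of "y + 4 * e" x] by (simp add: algebra_simps)
  show ?thesis
    using assms unfolding valleys_sink_def by (simp add: eq)
qed

text \<open>Sample \<open>F\<close> on a level that is fine in comparison with \<open>1 / (k - 1)\<close>, stretch \<open>[0,1]\<close> to \<open>[0,k-1]\<close> and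
  quantise.\<close>

lemma level_mor_approximation:
  assumes K: "fraisse_limit K" and F: "cont_open_surj (quot_top K) unit_top F"
    and zero: "F (quot_map K lim_zero) = 0" and k: "2 \<le> k"
  shows "\<exists>u. level_mor K k u \<and> (\<forall>x\<in>lim_pts K. \<bar>F (quot_map K x) - u x / (k - 1)\<bar> < 1 / (k - 1))"
proof -
  note S = fraisse_limit_lin_seq[OF K]
  define s where "s = real k - 1"
  have s: "1 \<le> s" using k by (simp add: s_def)
  \<comment> \<open>After stretching by \<open>s\<close>, the tolerance \<open>\<eta>\<close> becomes the \<open>1/8\<close> of the quantisation.\<close>
  define \<eta> where "\<eta> = 1 / (8 * s)"
  have \<eta>: "0 < \<eta>" "s * \<eta> = 1 / 8" using s by (auto simp: \<eta>_def)
  obtain m G where near: "\<And>x. x \<in> lim_pts K \<Longrightarrow> \<bar>F (quot_map K x) - G (x m)\<bar> < \<eta>"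
    and rng: "\<And>v. v < fst K m \<Longrightarrow> 0 \<le> G v \<and> G v \<le> 1"
    and slow: "\<And>v. Suc v < fst K m \<Longrightarrow> \<bar>G (Suc v) - G v\<bar> < 2 * \<eta>"
    and sink: "valleys_sink \<eta> (fst K m) G" "valleys_sink \<eta> (fst K m) (\<lambda>v. 1 - G v)"
    using finite_level_sample[OF K F \<eta>(1)] by blast
  define H where "H v = s * G v" for v
  have scale: "\<bar>s * p - s * q\<bar> < s * c" if "\<bar>p - q\<bar> < c" for p q c :: real
  proof -
    have "\<bar>s * p - s * q\<bar> = s * \<bar>p - q\<bar>" using s by (simp add: abs_mult flip: right_diff_distrib)
    then show ?thesis using that s by simp
  qed
  interpret slow_function H "fst K m"
  proof
    show "0 \<le> H v" if "v < fst K m" for v using rng[OF that] s by (simp add: H_def)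
    have "\<bar>0 - G 0\<bar> < \<eta>" using near[OF lim_zero_in[OF S]] zero by (simp add: lim_zero_def)
    from scale[OF this] show "H 0 \<le> 1/4" using \<eta> by (simp add: H_def)
    show "\<bar>H (Suc v) - H v\<bar> < 1/4" if "Suc v < fst K m" for v
      using scale[OF slow[OF that]] \<eta> by (simp add: H_def)
  qed
  have sinkH: "valleys_sink (1/8) (fst K m) H" "valleys_sink (1/8) (fst K m) (\<lambda>v. real k - 1 - H v)"
    using valleys_sink_scale[OF sink(1), of s, unfolded \<eta>(2)]
      valleys_sink_scale[OF sink(2), of s, unfolded \<eta>(2)] s
    by (simp_all add: H_def[abs_def] s_def right_diff_distrib)
  obtain x where x: "x \<in> lim_pts K" "F (quot_map K x) = 1" using lifted_surj[OF K F, of 1] by auto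
  have hit: "x m < fst K m" "real k - 1 - 1/8 \<le> H (x m)"
    using x(1) scale[OF near[OF x(1)]] \<eta> x(2) by (auto simp: lim_pts_iff H_def s_def)
  have top: "H v \<le> real k - 1" if "v < fst K m" for v
    using rng[OF that] s by (simp add: H_def s_def mult_left_le)
  have "lin_mor (fst K m) k (quantise H)"
    using fold_map_quantise[OF lin_seq_size[OF S] k top hit sinkH] by (simp add: lin_mor_iff_fold_map)
  then have "level_mor K k (\<lambda>x. quantise H (x m))"
    unfolding level_mor_def by blast
  moreover have "\<bar>F (quot_map K x) - quantise H (x m) / (k - 1)\<bar> < 1 / (k - 1)" if x: "x \<in> lim_pts K" for x
  proof -
    have "\<bar>s * F (quot_map K x) - H (x m)\<bar> < 1/8" using scale[OF near[OF x]] \<eta> by (simp add: H_def)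
    moreover have "\<bar>H (x m) - quantise H (x m)\<bar> < 3/4" using quantise_near x by (simp add: lim_pts_iff)
    ultimately have "\<bar>s * F (quot_map K x) - quantise H (x m)\<bar> < 1" by linarith
    moreover have "F (quot_map K x) - quantise H (x m) / s = (s * F (quot_map K x) - quantise H (x m)) / s"
      using s by (simp add: field_simps)
    moreover have "real (k - 1) = s" using k by (simp add: s_def)
    ultimately show ?thesis using s by (simp add: divide_strict_right_mono)
  qed
  ultimately show ?thesis by blast
qed

text \<open>Both maps are close to level morphisms to the same \<open>\<langle>k\<rangle>\<close>, and these are conjugate by homogeneity.
  Level morphisms send the endpoint to \<open>0\<close>; if its common value is \<open>1\<close>, the argument is applied to
  \<open>1 - F\<close> and \<open>1 - G\<close>.\<close>

lemma interval_maps_conjugate_up_to_small: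
  assumes K: "fraisse_limit K"
    and F: "cont_open_surj (quot_top K) unit_top F" and G: "cont_open_surj (quot_top K) unit_top G"
    and eq: "F (quot_map K lim_zero) = G (quot_map K lim_zero)" and \<delta>: "0 < \<delta>"
  shows "\<exists>h\<in>lim_Aut K. \<forall>x\<in>lim_pts K. \<bar>F (quot_map K (h x)) - G (quot_map K x)\<bar> < \<delta>"
proof -
  have zero: ?thesis
    if F: "cont_open_surj (quot_top K) unit_top F'" and G: "cont_open_surj (quot_top K) unit_top G'"
      and z: "F' (quot_map K lim_zero) = 0" "G' (quot_map K lim_zero) = 0"
      and same: "\<And>x y. \<bar>F' x - G' y\<bar> = \<bar>F x - G y\<bar>" for F' G'
  proof -
    obtain j where j: "2 / \<delta> < real j" using reals_Archimedean2 by blast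
    define k where "k = Suc (Suc j)"
    have k: "2 \<le> k" "2 / real (k - 1) < \<delta>"
      using j \<delta> by (auto simp: k_def field_simps)
    obtain u where u: "level_mor K k u"
      "\<And>x. x \<in> lim_pts K \<Longrightarrow> \<bar>F' (quot_map K x) - u x / (k - 1)\<bar> < 1 / (k - 1)"
      using level_mor_approximation[OF K F z(1) k(1)] by blast
    obtain v where v: "level_mor K k v"
      "\<And>x. x \<in> lim_pts K \<Longrightarrow> \<bar>G' (quot_map K x) - v x / (k - 1)\<bar> < 1 / (k - 1)"
      using level_mor_approximation[OF K G z(2) k(1)] by blast
    obtain h where h: "h \<in> lim_Aut K" "\<And>x. x \<in> lim_pts K \<Longrightarrow> u (h x) = v x"
      using fraisse_limit_homogeneous[OF K u(1) v(1)] by blast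
    have "\<bar>F (quot_map K (h x)) - G (quot_map K x)\<bar> < \<delta>" if x: "x \<in> lim_pts K" for x
    proof -
      have hx: "h x \<in> lim_pts K" using h(1) x by (auto simp: lim_Aut_def lim_mor_def)
      define e where "e = 1 / real (k - 1)"
      define w where "w = real (v x) / real (k - 1)"
      have "2 * e < \<delta>" using k(2) by (simp add: e_def)
      moreover have "\<bar>F' (quot_map K (h x)) - w\<bar> < e" "\<bar>G' (quot_map K x) - w\<bar> < e"
        using u(2)[OF hx] v(2)[OF x] unfolding h(2)[OF x] e_def w_def .
      ultimately have "\<bar>F' (quot_map K (h x)) - G' (quot_map K x)\<bar> < \<delta>" by linarith
      then show ?thesis by (simp add: same)
    qed
    then show ?thesis using h(1) by blast
  qed
  from endpoint_to_endpoint[OF K F] consider "F (quot_map K lim_zero) = 0" | "F (quot_map K lim_zero) = 1" by auto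
  then show ?thesis
  proof cases
    case 1
    then show ?thesis using zero[OF F G] eq by simp
  next
    case 2
    then show ?thesis
      using zero[OF cont_open_surj_comp[OF F cont_open_surj_flip] cont_open_surj_comp[OF G cont_open_surj_flip]] eq
      by (simp add: abs_minus_commute)
  qed
qed

section \<open>Comparing two maps onto a Knaster continuum\<close>

lemma knaster_dist_sums:
  assumes "\<And>n. \<bar>x n - y n\<bar> \<le> 1"
  shows "(\<lambda>n. \<bar>x n - y n\<bar> / 2 ^ (n + 1)) sums knaster_dist x y"
proof -
  have "(\<lambda>n. 1 / 2 ^ (n + 1) :: real) sums 1"
    using power_half_series by (simp add: power_one_over)
  then have "summable (\<lambda>n. \<bar>x n - y n\<bar> / 2 ^ (n + 1))"
    by (rule summable_comparison_test'[OF sums_summable]) (use assms in \<open>auto simp: divide_right_mono\<close>)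
  then show ?thesis unfolding knaster_dist_def by (rule summable_sums)
qed

lemma half_powers_tail: "(\<lambda>n. if n < N then 0 else 1 / 2 ^ (n + 1) :: real) sums (1 / 2 ^ N)"
proof -
  have "(\<lambda>n. 1 / 2 ^ N * (1 / 2 ^ (n + 1)) :: real) sums (1 / 2 ^ N * 1)"
    by (rule sums_mult) (use power_half_series in \<open>simp add: power_one_over\<close>)
  then have "(\<lambda>n. if n + N < N then 0 else 1 / 2 ^ (n + N + 1) :: real) sums (1 / 2 ^ N)"
    by (simp add: power_add mult_ac)
  from sums_iff_shift[THEN iffD1, OF this] show ?thesis by simp
qed

lemma knaster_dist_le:
  assumes xy: "\<And>n. \<bar>x n - y n\<bar> \<le> 1" and \<delta>: "0 \<le> \<delta>" "\<And>n. n < N \<Longrightarrow> \<bar>x n - y n\<bar> \<le> \<delta>"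
  shows "knaster_dist x y \<le> \<delta> + 1 / 2 ^ N"
proof -
  have "(\<lambda>n. \<delta> * (1 / 2 ^ (n + 1))) sums (\<delta> * 1)"
    by (rule sums_mult) (use power_half_series in \<open>simp add: power_one_over\<close>)
  from sums_add[OF this half_powers_tail[of N]]
  have "(\<lambda>n. \<delta> * (1 / 2 ^ (n + 1)) + (if n < N then 0 else 1 / 2 ^ (n + 1))) sums (\<delta> + 1 / 2 ^ N)" by simp
  then show ?thesis
  proof (rule sums_le[rotated 2])
    show "(\<lambda>n. \<bar>x n - y n\<bar> / 2 ^ (n + 1)) sums knaster_dist x y" by (rule knaster_dist_sums[OF xy])
    show "\<bar>x n - y n\<bar> / 2 ^ (n + 1) \<le> \<delta> * (1 / 2 ^ (n + 1)) + (if n < N then 0 else 1 / 2 ^ (n + 1))" for n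
    proof (cases "n < N")
      case True
      then show ?thesis using \<delta>(2)[OF True] by (simp add: divide_right_mono)
    next
      case False
      have "\<bar>x n - y n\<bar> / 2 ^ (n + 1) \<le> 1 / 2 ^ (n + 1)" using xy[of n] by (simp add: divide_right_mono)
      moreover have "0 \<le> \<delta> * (1 / 2 ^ (n + 1))" using \<delta>(1) by simp
      ultimately show ?thesis using False by simp
    qed
  qed
qed

lemma knaster_dist_eq_of_diverging:
  assumes "\<And>n. n < N \<Longrightarrow> x n = y n" "\<And>n. N \<le> n \<Longrightarrow> \<bar>x n - y n\<bar> = 1"
  shows "knaster_dist x y = 1 / 2 ^ N"
proof -
  have "(\<lambda>n. \<bar>x n - y n\<bar> / 2 ^ (n + 1)) = (\<lambda>n. if n < N then 0 else 1 / 2 ^ (n + 1))"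
    using assms by (auto simp: fun_eq_iff)
  then show ?thesis
    using sums_unique[OF half_powers_tail[of N]] by (simp add: knaster_dist_def)
qed

lemma knaster_seq_bond:
  assumes "is_knaster_seq T"
  shows "cont_open_surj unit_top unit_top (T n)"
  using assms by (simp add: is_knaster_seq_def)

lemma knaster_points_iff:
  "x \<in> topspace (knaster_top T) \<longleftrightarrow> (\<forall>n. x n \<in> {0..1}) \<and> (\<forall>n. T n (x (Suc n)) = x n)"
  by (simp add: knaster_top_def topspace_invlim)

text \<open>Earlier coordinates are uniformly continuous functions of the coordinate \<open>M\<close>.\<close>

lemma coordinate_controls_earlier_coordinates:
  assumes T: "is_knaster_seq T" and "0 < \<delta>"
  shows "\<exists>\<delta>'>0. \<forall>x\<in>topspace (knaster_top T). \<forall>y\<in>topspace (knaster_top T).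
    \<bar>x M - y M\<bar> < \<delta>' \<longrightarrow> (\<forall>n\<le>M. \<bar>x n - y n\<bar> < \<delta>)"
  using \<open>0 < \<delta>\<close>
proof (induction M arbitrary: \<delta>)
  case 0
  then show ?case by auto
next
  case (Suc M)
  obtain d where d: "0 < d" "\<And>x y n. x \<in> topspace (knaster_top T) \<Longrightarrow> y \<in> topspace (knaster_top T) \<Longrightarrow>
    \<bar>x M - y M\<bar> < d \<Longrightarrow> n \<le> M \<Longrightarrow> \<bar>x n - y n\<bar> < \<delta>"
    using Suc.IH[OF Suc.prems] by blast
  have "continuous_on {0..1} (T M)"
    using knaster_seq_bond[OF T, of M] by (simp add: cont_open_surj_def)
  then have "uniformly_continuous_on {0..1} (T M)"
    by (rule compact_uniformly_continuous) simp
  then obtain e where e: "0 < e" "\<And>s t. s \<in> {0..1} \<Longrightarrow> t \<in> {0..1} \<Longrightarrow> dist t s < e \<Longrightarrow> dist (T M t) (T M s) < d"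
    unfolding uniformly_continuous_on_def using d(1) by meson
  have "\<bar>x n - y n\<bar> < \<delta>" if xy: "x \<in> topspace (knaster_top T)" "y \<in> topspace (knaster_top T)"
    and close: "\<bar>x (Suc M) - y (Suc M)\<bar> < min e \<delta>" and n: "n \<le> Suc M" for x y n
  proof (cases "n = Suc M")
    case False
    have "dist (T M (x (Suc M))) (T M (y (Suc M))) < d"
      using xy close by (intro e(2)) (auto simp: knaster_points_iff dist_real_def)
    then have "\<bar>x M - y M\<bar> < d" using xy by (simp add: knaster_points_iff dist_real_def)
    then show ?thesis using d(2)[OF xy] n False by simp
  qed (use close in simp)
  then show ?case using e(1) Suc.prems by (intro exI[of _ "min e \<delta>"]) auto
qed

lemma sup_dist_le:
  assumes "X \<noteq> {}" "\<And>x. x \<in> X \<Longrightarrow> knaster_dist (u x) (v x) \<le> c"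
  shows "sup_dist X u v \<le> c"
  unfolding sup_dist_def by (rule cSUP_least) (use assms in auto)

text \<open>Since a coordinate determines the earlier ones, sequences that differ somewhere differ from then on, and
  for values in \<open>{0,1}\<close> by exactly \<open>1\<close>. So if \<open>N\<close> is the first difference, the distance is \<open>1 / 2 ^ N\<close>.\<close>

lemma matching_coordinates_at_endpoint:
  assumes ends: "\<And>n. x n \<in> {0, 1}" "\<And>n. y n \<in> {0, 1::real}"
    and thread: "\<And>n. T n (x (Suc n)) = x n" "\<And>n. T n (y (Suc n)) = y n"
    and dist: "knaster_dist x y < \<epsilon>" and \<epsilon>: "0 < \<epsilon>"
  shows "\<exists>N. (\<forall>n<N. x n = y n) \<and> 1 / 2 ^ N < \<epsilon>"
proof (cases "\<forall>n. x n = y n")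
  case True
  obtain N where "(1 / 2) ^ N < \<epsilon>" using real_arch_pow_inv[OF \<epsilon>, of "1/2"] by auto
  then show ?thesis using True by (intro exI[of _ N]) (simp add: power_one_over)
next
  case False
  define N where "N = (LEAST n. x n \<noteq> y n)"
  have N: "x N \<noteq> y N" unfolding N_def by (rule LeastI_ex) (use False in blast)
  have before: "x n = y n" if "n < N" for n using not_less_Least[OF that[unfolded N_def]] by simp
  have "x n \<noteq> y n" if "N \<le> n" for n
    using that N
  proof (induction n rule: dec_induct)
    case (step n)
    then show ?case using thread(1)[of n] thread(2)[of n] by metis
  qed
  then have "\<bar>x n - y n\<bar> = 1" if "N \<le> n" for n
    using ends(1)[of n] ends(2)[of n] that by (smt (verit) insert_iff singletonD)
  from knaster_dist_eq_of_diverging[OF before this] show ?thesis using before dist by auto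
qed

theorem theorem5p1:
  fixes K :: lin_seq and T :: "nat \<Rightarrow> real \<Rightarrow> real"
    and f g :: "(nat \<Rightarrow> nat) set \<Rightarrow> nat \<Rightarrow> real" and \<epsilon> :: real
  assumes "fraisse_limit K"
    and "is_knaster_seq T"
    and "cont_open_surj (quot_top K) (knaster_top T) f"
    and "cont_open_surj (quot_top K) (knaster_top T) g"
    and "\<epsilon> > 0"
    and "knaster_dist (f (quot_map K lim_zero)) (g (quot_map K lim_zero)) < \<epsilon>"
  shows "\<exists>h\<in>lim_Aut K. sup_dist (topspace (quot_top K)) (f \<circ> Phi K h) g < \<epsilon>"
proof -
  note K = assms(1) and T = assms(2) and f = assms(3) and g = assms(4)
  note S = fraisse_limit_lin_seq[OF K]
  define c where "c = quot_map K lim_zero"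
  have zero: "lim_zero \<in> lim_pts K" by (rule lim_zero_in[OF S])
  have proj: "cont_open_surj (knaster_top T) unit_top (\<lambda>x. x n)" for n
    unfolding knaster_top_def by (rule cont_open_surj_projection) (rule knaster_seq_bond[OF T])
  have F: "cont_open_surj (quot_top K) unit_top (\<lambda>C. f C n)"
    and G: "cont_open_surj (quot_top K) unit_top (\<lambda>C. g C n)" for n
    using cont_open_surj_comp[OF f proj] cont_open_surj_comp[OF g proj] by auto
  have fL: "f C \<in> topspace (knaster_top T)" and gL: "g C \<in> topspace (knaster_top T)"
    if "C \<in> topspace (quot_top K)" for C
    using f g that by (auto simp: cont_open_surj_def)
  have q: "quot_map K x \<in> topspace (quot_top K)" if "x \<in> lim_pts K" for x
    using that by (simp add: topspace_quot_top)
  have "\<exists>N. (\<forall>n<N. f c n = g c n) \<and> 1 / 2 ^ N < \<epsilon>"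
    unfolding c_def
  proof (rule matching_coordinates_at_endpoint[where T = T])
    show "f (quot_map K lim_zero) n \<in> {0, 1}" "g (quot_map K lim_zero) n \<in> {0, 1}" for n
      using endpoint_to_endpoint[OF K F] endpoint_to_endpoint[OF K G] by auto
  qed (use fL[OF q[OF zero]] gL[OF q[OF zero]] assms(5,6) in \<open>auto simp: knaster_points_iff\<close>)
  then obtain N where N: "\<And>n. n < N \<Longrightarrow> f c n = g c n" "1 / 2 ^ N < \<epsilon>" by blast
  \<comment> \<open>The coordinates from \<open>N\<close> on contribute at most \<open>1 / 2 ^ N\<close> whatever \<open>h\<close> is; \<open>\<delta>\<close> is for the others.\<close>
  define \<delta> where "\<delta> = (\<epsilon> - 1 / 2 ^ N) / 2"
  have \<delta>: "0 < \<delta>" "\<delta> + 1 / 2 ^ N < \<epsilon>" using N(2) by (auto simp: \<delta>_def field_simps)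
  obtain \<delta>' where \<delta>': "0 < \<delta>'" "\<And>x y n. x \<in> topspace (knaster_top T) \<Longrightarrow> y \<in> topspace (knaster_top T) \<Longrightarrow>
      \<bar>x (N - 1) - y (N - 1)\<bar> < \<delta>' \<Longrightarrow> n \<le> N - 1 \<Longrightarrow> \<bar>x n - y n\<bar> < \<delta>"
    using coordinate_controls_earlier_coordinates[OF T \<delta>(1), of "N - 1"] by blast
  have "\<exists>h\<in>lim_Aut K. \<forall>x\<in>lim_pts K. \<forall>n<N. \<bar>f (quot_map K (h x)) n - g (quot_map K x) n\<bar> < \<delta>"
  proof (cases "N = 0")
    case True
    \<comment> \<open>No coordinate has to be matched, so any automorphism will do.\<close>
    have "level_mor K (fst K 0) (\<lambda>x. x 0)" by (rule level_mor_projection[OF S])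
    then show ?thesis using fraisse_limit_homogeneous[OF K] True by blast
  next
    case False
    then have "f c (N - 1) = g c (N - 1)" using N(1) by simp
    then obtain h where h: "h \<in> lim_Aut K"
      "\<And>x. x \<in> lim_pts K \<Longrightarrow> \<bar>f (quot_map K (h x)) (N - 1) - g (quot_map K x) (N - 1)\<bar> < \<delta>'"
      using interval_maps_conjugate_up_to_small[OF K F G _ \<delta>'(1), of "N - 1" "N - 1"] by (auto simp: c_def)
    have "\<bar>f (quot_map K (h x)) n - g (quot_map K x) n\<bar> < \<delta>" if "x \<in> lim_pts K" "n < N" for x n
    proof -
      have "h x \<in> lim_pts K" using h(1) that(1) by (auto simp: lim_Aut_def lim_mor_def)
      then show ?thesis using \<delta>'(2)[OF fL[OF q] gL[OF q] h(2)] that by simp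
    qed
    then show ?thesis using h(1) by blast
  qed
  then obtain h where h: "h \<in> lim_Aut K"
    "\<And>x n. x \<in> lim_pts K \<Longrightarrow> n < N \<Longrightarrow> \<bar>f (quot_map K (h x)) n - g (quot_map K x) n\<bar> < \<delta>" by blast
  have "sup_dist (topspace (quot_top K)) (f \<circ> Phi K h) g \<le> \<delta> + 1 / 2 ^ N"
  proof (rule sup_dist_le)
    show "topspace (quot_top K) \<noteq> {}" using q[OF zero] by blast
    fix C assume "C \<in> topspace (quot_top K)"
    then obtain x where x: "x \<in> lim_pts K" and C: "C = quot_map K x"
      by (auto simp: topspace_quot_top)
    have hx: "h x \<in> lim_pts K" using h(1) x by (auto simp: lim_Aut_def lim_mor_def)
    have "knaster_dist (f (quot_map K (h x))) (g (quot_map K x)) \<le> \<delta> + 1 / 2 ^ N"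
    proof (rule knaster_dist_le)
      show "\<bar>f (quot_map K (h x)) n - g (quot_map K x) n\<bar> \<le> 1" for n
      proof -
        have "f (quot_map K (h x)) n \<in> {0..1}" "g (quot_map K x) n \<in> {0..1}"
          using fL[OF q[OF hx]] gL[OF q[OF x]] by (auto simp: knaster_points_iff)
        then show ?thesis by auto
      qed
    qed (use h(2)[OF x] \<delta>(1) in \<open>auto intro: less_imp_le\<close>)
    then show "knaster_dist ((f \<circ> Phi K h) C) (g C) \<le> \<delta> + 1 / 2 ^ N"
      using Phi_quot_map[OF h(1) x] by (simp add: C)
  qed
  then show ?thesis using h(1) \<delta>(2) by (intro bexI[of _ h]) auto
qed

end
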